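(* Let $p$ be a prime, let $H$ be a positive integer and let $\mathcal U\subset \mathbb F_p^*$ satisfy $|\mathcal U\cdot\mathcal U|<10|\mathcal U|$. Let $J$ be the number of solutions of the congruence $$x\equiv yr \pmod p,\qquad x,y\in\mathbb N,\quad x,y\le H,\quad r\in\mathcal U.$$ Then: (i) If for some fixed positive integer $n$ we have $|\mathcal U|<p^{n/(2n+1)}$ and $|\mathcal U|H^n<p$, then $J\lesssim H$. (ii) If $|\mathcal U|<p^{2/5}$, then $$J\lesssim H+\frac{|\mathcal U|H^2}{p}+\frac{|\mathcal U|^{3/4}H}{p^{1/4}}.$$
   Context: $\mathbb F_p$ is the field of residue classes modulo $p$, and $\mathcal A\cdot\mathcal B=\{ab: a\in\mathcal A, b\in\mathcal B\}$. The notation $A\lesssim B$ means $|A|<|B|p^{o(1)}$, i.e. for every $\eta>0$ there is a constant $c(\eta)$ (which in part (i) may also depend on $n$, but not on $p$, $H$ or $\mathcal U$) such that $|A|<c(\eta)|B|p^{\eta}$. *)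

theory Defs
  imports Complex_Main "HOL-Number_Theory.Residues" "HOL-Algebra.Coset"
begin

text \<open>
  The prime \<open>p\<close> has to vary inside the statement (implied constants are uniform in \<open>p\<close>), so the
  field \<open>F\<^sub>p\<close> is the ring \<^term>\<open>residue_ring (int p)\<close> on the carrier \<open>{0..p-1}\<close>.
  Its product sets are given by \<^term>\<open>set_mult (residue_ring (int p))\<close>.
\<close>

definition small_doubling :: "nat \<Rightarrow> int set \<Rightarrow> bool" where
  "small_doubling p U \<longleftrightarrow>
     U \<subseteq> Units (residue_ring (int p)) \<and>
     card (U <#>\<^bsub>residue_ring (int p)\<^esub> U) < 10 * card U"

text \<open>Here \<open>x, y \<in> \<nat>\<close> are positive: counting \<open>x = y = 0\<close> would add \<open>|U|\<close> trivial solutions.\<close>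

definition J :: "nat \<Rightarrow> nat \<Rightarrow> int set \<Rightarrow> nat" where
  "J p H U = card {(x, y, r). x \<in> {1..H} \<and> y \<in> {1..H} \<and> r \<in> U \<and> [int x = int y * r] (mod int p)}"

end

theory Submission
  imports Defs
begin

text \<open>
  Let \<open>A(h)\<close> be the set of reduced fractions \<open>x/y\<close> with \<open>x, y \<le> h\<close> whose residue modulo \<open>p\<close> lies
  in \<open>U\<close>. Sorting the solutions by \<open>gcd(x, y)\<close> gives \<open>J \<le> \<Sum>\<^sub>d |A(H/d)|\<close>, so it suffices to bound
  \<open>|A(h)|\<close>.

  The \<open>m\<close>-fold products of elements of \<open>A(h)\<close> are fractions of height at most \<open>h\<^sup>m\<close> whose residues
  lie in \<open>U\<^sup>m\<close>, and \<open>|U\<^sup>m| \<le> 10\<^sup>m |U|\<close> by Petridis' proof of Pluennecke's inequality. Two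
  reduced fractions with the same residue have a cross determinant divisible by \<open>p\<close>, so a single
  residue carries \<open>O(1 + h\<^sup>2\<^sup>m/p)\<close> of them. Conversely, averaging over sets \<open>S\<close> of primes yields a
  subset of \<open>A(h)\<close> of size at least \<open>|A(h)| p\<^sup>-\<^sup>o\<^sup>(\<^sup>1\<^sup>)\<close> in which numerators are composed of primes in \<open>S\<close>
  and denominators of primes outside \<open>S\<close>; products of its elements are already reduced, hence by the
  divisor bound each product has only \<open>p\<^sup>o\<^sup>(\<^sup>1\<^sup>)\<close> representations. Altogether
  \<open>|A(h)|\<^sup>m \<le> |U| (1 + h\<^sup>2\<^sup>m/p) p\<^sup>o\<^sup>(\<^sup>1\<^sup>)\<close> for every fixed \<open>m\<close>, and both parts follow by choosing \<open>m\<close>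
  depending on \<open>h\<close>.
\<close>

subsection \<open>Iterated product sets and the divisor bound\<close>

text \<open>Induction on \<open>C\<close>. When \<open>c\<close> is added, let \<open>W\<close>
  consist of the \<open>x\<close> in \<open>X\<close> with \<open>x c\<close> already in
  \<open>X C\<close>. All products \<open>w u c\<close> with \<open>w\<close> in \<open>W\<close>
  already lie in \<open>X U C\<close>, so at most \<open>|X U| - |W U|\<close> products are new.
  Minimality of \<open>|X U| / |X|\<close> bounds this by \<open>(|X U| / |X|) (|X| - |W|)\<close>,
  and \<open>|X| - |W|\<close> is exactly the growth of \<open>X C\<close>.\<close>

lemma (in comm_group) set_mult_minimal_ratio:
  assumes X: "X \<subseteq> carrier G" "finite X" and U: "U \<subseteq> carrier G" "finite U"
    and minimal: "\<And>W. W \<subseteq> X \<Longrightarrow> card (X <#> U) * card W \<le> card (W <#> U) * card X"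
    and C: "finite C" "C \<subseteq> carrier G"
  shows "card (X <#> (U <#> C)) * card X \<le> card (X <#> U) * card (X <#> C)"
  using C
proof (induction C rule: finite_induct)
  case empty
  then show ?case by (simp add: set_mult_def)
next
  case (insert c C)
  have c: "c \<in> carrier G" and C: "C \<subseteq> carrier G" using insert by auto
  have fin: "finite (A <#> B)" if "finite A" "finite B" for A B :: "'a set"
    using that by (simp add: set_mult_def)
  define W where "W = {x \<in> X. x \<otimes> c \<in> X <#> C}"
  have W: "W \<subseteq> X" "finite W" unfolding W_def using X by auto
  have inj: "inj_on (\<lambda>z. z \<otimes> c) (carrier G)"
    using c by (auto intro!: inj_onI)
  have XC: "X <#> insert c C = (X <#> C) \<union> (\<lambda>z. z \<otimes> c) ` (X - W)"
    unfolding W_def set_mult_def by blast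
  have "card (X <#> insert c C) = card (X <#> C) + card ((\<lambda>z. z \<otimes> c) ` (X - W))"
    unfolding XC by (rule card_Un_disjoint) (use X insert in \<open>auto simp: fin W_def\<close>)
  also have "card ((\<lambda>z. z \<otimes> c) ` (X - W)) = card (X - W)"
    by (rule card_image) (use inj X in \<open>auto intro: inj_on_subset\<close>)
  also have "\<dots> = card X - card W"
    using W by (simp add: card_Diff_subset)
  finally have cXC: "card (X <#> insert c C) = card (X <#> C) + (card X - card W)" .
  have WU: "W <#> U \<subseteq> X <#> U" using W by (auto simp: set_mult_def)
  have sub: "X <#> (U <#> insert c C) \<subseteq> (X <#> (U <#> C)) \<union> (\<lambda>z. z \<otimes> c) ` ((X <#> U) - (W <#> U))"
  proof
    fix z assume "z \<in> X <#> (U <#> insert c C)"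
    then obtain x u d where z: "z = x \<otimes> (u \<otimes> d)" "x \<in> X" "u \<in> U" "d \<in> insert c C"
      by (auto simp: set_mult_def)
    have xu: "x \<in> carrier G" "u \<in> carrier G" using z X U by auto
    show "z \<in> (X <#> (U <#> C)) \<union> (\<lambda>z. z \<otimes> c) ` ((X <#> U) - (W <#> U))"
    proof (cases "d \<in> C")
      case True
      then show ?thesis using z by (auto simp: set_mult_def)
    next
      case False
      then have "d = c" using z by auto
      then have zc: "z = (x \<otimes> u) \<otimes> c" using z xu c by (simp add: m_assoc)
      show ?thesis
      proof (cases "x \<otimes> u \<in> W <#> U")
        case True
        then obtain w v where wv: "x \<otimes> u = w \<otimes> v" "w \<in> W" "v \<in> U"
          by (auto simp: set_mult_def)
        then obtain x' c' where x': "w \<otimes> c = x' \<otimes> c'" "x' \<in> X" "c' \<in> C"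
          by (auto simp: set_mult_def W_def)
        have cl: "w \<in> carrier G" "v \<in> carrier G" "x' \<in> carrier G" "c' \<in> carrier G"
          using wv x' W X U C by auto
        \<comment> \<open>Commutativity moves \<open>c\<close> next to \<open>w\<close>, where the
          definition of \<open>W\<close> trades \<open>w c\<close> for some
          \<open>x' c'\<close>.\<close>
        have "z = (w \<otimes> c) \<otimes> v"
          using zc wv cl c by (simp add: m_ac)
        also have "\<dots> = x' \<otimes> (v \<otimes> c')"
          using x' cl by (simp add: m_ac)
        finally show ?thesis using x' wv by (auto simp: set_mult_def)
      next
        case False
        moreover have "x \<otimes> u \<in> X <#> U" using z by (auto simp: set_mult_def)
        ultimately show ?thesis using zc by blast
      qed
    qed
  qed
  have "card (X <#> (U <#> insert c C))
      \<le> card ((X <#> (U <#> C)) \<union> (\<lambda>z. z \<otimes> c) ` ((X <#> U) - (W <#> U)))"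
    by (rule card_mono[OF _ sub]) (use X U insert in \<open>auto simp: fin\<close>)
  also have "\<dots> \<le> card (X <#> (U <#> C)) + card ((\<lambda>z. z \<otimes> c) ` ((X <#> U) - (W <#> U)))"
    by (rule card_Un_le)
  also have "card ((\<lambda>z. z \<otimes> c) ` ((X <#> U) - (W <#> U))) \<le> card ((X <#> U) - (W <#> U))"
    by (rule card_image_le) (use X U in \<open>auto simp: fin\<close>)
  also have "\<dots> = card (X <#> U) - card (W <#> U)"
    by (rule card_Diff_subset[OF _ WU]) (use W U in \<open>auto simp: fin\<close>)
  finally have "card (X <#> (U <#> insert c C)) * card X
      \<le> (card (X <#> (U <#> C)) + (card (X <#> U) - card (W <#> U))) * card X" by simp
  also have "\<dots> = card (X <#> (U <#> C)) * card X
      + (card (X <#> U) * card X - card (W <#> U) * card X)"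
    by (simp add: algebra_simps)
  \<comment> \<open>The induction hypothesis bounds the old products. Minimality at \<open>W\<close>
    enlarges the term being subtracted, and truncated subtraction is antitone in that term.\<close>
  also have "\<dots> \<le> card (X <#> U) * card (X <#> C)
      + (card (X <#> U) * card X - card (X <#> U) * card W)"
    using insert minimal[OF W(1)] by (intro add_mono diff_le_mono2) auto
  also have "\<dots> = card (X <#> U) * card (X <#> insert c C)"
    unfolding cXC by (simp add: algebra_simps)
  finally show ?case .
qed

text \<open>Take a nonempty \<open>X\<close> inside \<open>U\<close> minimizing
  \<open>|X U| / |X|\<close>. Comparison with \<open>U\<close> itself shows that the minimum is at
  most \<open>K\<close>. Applying the previous lemma with \<open>C = U^m\<close> repeatedly gives
  \<open>|X U^m| \<le> K^m |X|\<close>, and a translate of \<open>U^m\<close> by an element of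
  \<open>X\<close> sits inside \<open>X U^m\<close>.\<close>

lemma (in comm_group) card_iterated_set_mult_le:
  fixes K :: nat
  assumes U: "U \<subseteq> carrier G" "finite U" "U \<noteq> {}" and doubling: "card (U <#> U) \<le> K * card U"
  shows "card (((<#>) U ^^ m) {\<one>}) \<le> K ^ m * card U"
proof -
  define ratio where "ratio X = real (card (X <#> U)) / real (card X)" for X
  define F where "F = {X. X \<subseteq> U \<and> X \<noteq> {}}"
  have "finite F" "F \<noteq> {}" using U unfolding F_def by auto
  then obtain X where X: "X \<in> F" "\<And>W. W \<in> F \<Longrightarrow> ratio X \<le> ratio W"
    by (metis arg_min_if_finite(1) arg_min_least)
  have XU: "X \<subseteq> U" "X \<noteq> {}" "finite X" "X \<subseteq> carrier G"
    using X U finite_subset unfolding F_def by auto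
  then have cX: "card X > 0" by (simp add: card_gt_0_iff)
  have minimal: "card (X <#> U) * card W \<le> card (W <#> U) * card X" if "W \<subseteq> X" for W
  proof (cases "W = {}")
    case False
    then have "W \<in> F" using that XU by (auto simp: F_def)
    have "finite W" using that XU finite_subset by blast
    then have "card W > 0" using False by (simp add: card_gt_0_iff)
    moreover have "ratio X \<le> ratio W" using X \<open>W \<in> F\<close> by blast
    ultimately have "real (card (X <#> U)) * real (card W) \<le> real (card (W <#> U)) * real (card X)"
      using cX by (simp add: ratio_def field_simps)
    then show ?thesis by (metis of_nat_le_iff of_nat_mult)
  qed simp
  have "card (X <#> U) * card U \<le> K * card X * card U"
  proof -
    have "ratio X \<le> ratio U" using X U by (auto simp: F_def)
    then have "real (card (X <#> U)) * real (card U) \<le> real (card (U <#> U)) * real (card X)"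
      using cX U by (simp add: ratio_def field_simps card_gt_0_iff)
    then have "card (X <#> U) * card U \<le> card (U <#> U) * card X"
      by (metis of_nat_le_iff of_nat_mult)
    also have "\<dots> \<le> K * card U * card X" using doubling by simp
    finally show ?thesis by (simp add: mult_ac)
  qed
  then have KX: "card (X <#> U) \<le> K * card X" using U by (simp add: card_gt_0_iff)
  define P where "P m = ((<#>) U ^^ m) {\<one>}" for m
  have P: "P m \<subseteq> carrier G \<and> finite (P m)" for m
  proof (induction m)
    case (Suc m)
    then have "U <#> P m \<subseteq> carrier G \<and> finite (U <#> P m)"
      using U by (auto simp: set_mult_def)
    then show ?case by (simp add: P_def)
  qed (simp add: P_def)
  have step: "card (X <#> P m) \<le> K ^ m * card X" for m
  proof (induction m)
    case 0
    have "X <#> {\<one>} = X" using XU by (force simp: set_mult_def)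
    then show ?case by (simp add: P_def)
  next
    case (Suc m)
    have "card (X <#> (U <#> P m)) * card X \<le> card (X <#> U) * card (X <#> P m)"
      by (rule set_mult_minimal_ratio) (use XU U minimal P in auto)
    also have "\<dots> \<le> (K * card X) * (K ^ m * card X)"
      by (intro mult_mono KX Suc) auto
    finally have "card (X <#> (U <#> P m)) \<le> K * (K ^ m * card X)"
      using cX by (simp add: mult_ac)
    then show ?case by (simp add: P_def)
  qed
  obtain x where x: "x \<in> X" using XU by auto
  then have xc: "x \<in> carrier G" using XU by auto
  have "card (P m) = card ((\<lambda>y. x \<otimes> y) ` P m)"
    by (rule card_image[symmetric]) (use P[of m] xc in \<open>auto intro!: inj_onI simp: subset_iff\<close>)
  also have "\<dots> \<le> card (X <#> P m)"
    by (rule card_mono) (use x P[of m] XU in \<open>auto simp: set_mult_def\<close>)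
  also have "\<dots> \<le> K ^ m * card X" by (rule step)
  also have "\<dots> \<le> K ^ m * card U"
    using XU U by (intro mult_left_mono card_mono) auto
  finally show ?thesis by (simp add: P_def)
qed

section \<open>The divisor bound\<close>

lemma card_divisors_prime_power_mult_le:
  fixes n m q k :: nat
  assumes "n = q ^ k * m" "prime q" "m > 0"
  shows "card {d. d dvd n} \<le> (k + 1) * card {d. d dvd m}"
proof -
  have "{d. d dvd n} \<subseteq> (\<lambda>(j, e). q ^ j * e) ` ({..k} \<times> {d. d dvd m})"
  proof
    fix d assume "d \<in> {d. d dvd n}"
    then have "d dvd q ^ k * m" using assms by auto
    then obtain a b where ab: "d = a * b" "a dvd q ^ k" "b dvd m"
      by (meson division_decomp)
    obtain j where "j \<le> k" "a = q ^ j"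
      using ab(2) assms(2) by (metis divides_primepow_nat)
    then show "d \<in> (\<lambda>(j, e). q ^ j * e) ` ({..k} \<times> {d. d dvd m})"
      using ab by force
  qed
  then have "card {d. d dvd n} \<le> card ((\<lambda>(j, e). q ^ j * e) ` ({..k} \<times> {d. d dvd m}))"
    by (intro card_mono) (use assms in auto)
  also have "\<dots> \<le> card ({..k} \<times> {d. d dvd m})"
    by (rule card_image_le) (use assms in auto)
  also have "\<dots> = (k + 1) * card {d. d dvd m}"
    by (simp add: card_cartesian_product)
  finally show ?thesis .
qed

text \<open>Prime powers \<open>q^k\<close> are stripped off one at a time, each contributing a
  factor \<open>k + 1\<close>. For large \<open>q\<close> this is at most
  \<open>q^(k \<epsilon>)\<close>; for \<open>q < B\<close> it costs a further factor
  \<open>D\<close>. At most \<open>B\<close> primes are small, so the total loss is at most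
  \<open>D^B\<close>.\<close>

lemma divisor_bound:
  fixes \<epsilon> :: real
  assumes "\<epsilon> > 0"
  obtains C :: real where "C \<ge> 1" "\<And>n::nat. n \<ge> 1 \<Longrightarrow> real (card {d. d dvd n}) \<le> C * real n powr \<epsilon>"
proof -
  \<comment> \<open>\<open>B\<close> makes \<open>q powr \<epsilon>\<close> at least 2 for
    \<open>q \<ge> B\<close>, so that \<open>k + 1 \<le> 2^k\<close> suffices there.
    \<open>D\<close> satisfies \<open>D \<ge> 1\<close> and
    \<open>D \<epsilon> ln 2 \<ge> 1\<close>, so that \<open>k + 1 \<le> D (1 + k \<epsilon> ln 2)
    \<le> D 2^(k \<epsilon>)\<close> for every \<open>k\<close>.\<close>
  define B where "B = nat \<lceil>2 powr (1 / \<epsilon>)\<rceil>"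
  define D where "D = max 1 (1 / (\<epsilon> * ln 2))"
  have D1: "D \<ge> 1" by (simp add: D_def)
  have De: "D * (\<epsilon> * ln 2) \<ge> 1"
  proof -
    have "1 = 1 / (\<epsilon> * ln 2) * (\<epsilon> * ln 2)" using assms by simp
    also have "\<dots> \<le> D * (\<epsilon> * ln 2)"
      by (rule mult_right_mono) (use assms in \<open>auto simp: D_def\<close>)
    finally show ?thesis .
  qed
  have small: "real (k + 1) \<le> D * (real q ^ k) powr \<epsilon>" if "q \<ge> 2" for q k :: nat
  proof -
    have "real (k + 1) \<le> D + real k * (D * (\<epsilon> * ln 2))"
      using D1 mult_left_mono[OF De, of "real k"] by simp
    also have "\<dots> = D * (1 + real k * \<epsilon> * ln 2)" by (simp add: algebra_simps)
    also have "\<dots> \<le> D * exp (real k * \<epsilon> * ln 2)"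
      using D1 exp_ge_add_one_self[of "real k * \<epsilon> * ln 2"] by (intro mult_left_mono) auto
    also have "exp (real k * \<epsilon> * ln 2) = (2 ^ k) powr \<epsilon>"
      by (simp add: powr_def ln_realpow mult_ac)
    also have "D * (2 ^ k) powr \<epsilon> \<le> D * (real q ^ k) powr \<epsilon>"
      using D1 that assms by (intro mult_left_mono powr_mono2 power_mono) auto
    finally show ?thesis .
  qed
  have large: "real (k + 1) \<le> (real q ^ k) powr \<epsilon>" if "q \<ge> B" for q k :: nat
  proof -
    have "real q \<ge> 2 powr (1 / \<epsilon>)" using that unfolding B_def by linarith
    then have "real q powr \<epsilon> \<ge> (2 powr (1 / \<epsilon>)) powr \<epsilon>"
      using assms by (intro powr_mono2) auto
    then have q: "real q powr \<epsilon> \<ge> 2" using assms by (simp add: powr_powr)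
    have "k + 1 \<le> 2 ^ k" by (induction k) auto
    then have "real (k + 1) \<le> 2 ^ k"
      by (metis of_nat_le_iff of_nat_numeral of_nat_power)
    also have "\<dots> \<le> (real q powr \<epsilon>) ^ k" using q by (intro power_mono) auto
    also have "\<dots> = (real q ^ k) powr \<epsilon>"
      by (induction k) (simp_all add: powr_mult)
    finally show ?thesis .
  qed
  define S where "S n = {q \<in> prime_factors n. q < B}" for n :: nat
  have fS: "finite (S n)" for n by (simp add: S_def)
  \<comment> \<open>The exponent counts the small primes that actually divide \<open>n\<close>,
    which lets the induction pay \<open>D\<close> once per small prime; the uniform exponent
    \<open>B\<close> replaces it only at the end.\<close>
  have main: "real (card {d. d dvd n}) \<le> D ^ card (S n) * real n powr \<epsilon>" if "n \<ge> 1" for n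
    using that
  proof (induction n rule: less_induct)
    case (less n)
    show ?case
    proof (cases "n = 1")
      case True
      then show ?thesis by (simp add: S_def)
    next
      case False
      then obtain q where q: "prime q" "q dvd n" using prime_factor_nat by blast
      define k where "k = multiplicity q n"
      obtain m where m: "n = q ^ k * m" "\<not> q dvd m"
        unfolding k_def by (rule multiplicity_decompose'[of n q]) (use q less in auto)
      have k: "k \<ge> 1" using q less unfolding k_def
        by (simp add: Suc_le_eq prime_multiplicity_gt_zero_iff)
      have m0: "m \<ge> 1" using m less by (cases m) auto
      have q2: "q \<ge> 2" using q prime_ge_2_nat by auto
      have "q ^ k > 1" using q2 k by (intro one_less_power) auto
      then have "m < n" using m m0 by simp
      note IH = less.IH[OF this m0]
      have pf: "prime_factors n = insert q (prime_factors m)"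
      proof -
        have "prime_factors n = prime_factors (q ^ k) \<union> prime_factors m"
          unfolding m(1) by (rule prime_factors_product) (use q2 m0 in auto)
        also have "prime_factors (q ^ k) = {q}" using q k
          by (simp add: prime_factorization_prime_power)
        finally show ?thesis by simp
      qed
      have qm: "q \<notin> prime_factors m" using m by auto
      have split: "real n powr \<epsilon> = (real q ^ k) powr \<epsilon> * real m powr \<epsilon>"
        using m by (simp add: powr_mult)
      have "real (card {d. d dvd n}) \<le> real ((k + 1) * card {d. d dvd m})"
        using card_divisors_prime_power_mult_le[OF m(1) q(1)] m0 by (simp del: of_nat_mult)
      also have "\<dots> = real (k + 1) * real (card {d. d dvd m})" by (rule of_nat_mult)
      also have "\<dots> \<le> real (k + 1) * (D ^ card (S m) * real m powr \<epsilon>)"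
        using IH by (intro mult_left_mono) auto
      also have "\<dots> \<le> D ^ card (S n) * real n powr \<epsilon>"
      proof (cases "q < B")
        case True
        have "S n = insert q (S m)" unfolding S_def pf using True by auto
        then have "card (S n) = Suc (card (S m))" using qm fS by (simp add: S_def)
        then have "D ^ card (S n) * real n powr \<epsilon>
            = (D * (real q ^ k) powr \<epsilon>) * (D ^ card (S m) * real m powr \<epsilon>)"
          by (simp add: split mult_ac)
        then show ?thesis using small[OF q2, of k] D1 by (simp add: mult_right_mono)
      next
        case False
        have "S n = S m" unfolding S_def pf using False by auto
        then have "D ^ card (S n) * real n powr \<epsilon>
            = (real q ^ k) powr \<epsilon> * (D ^ card (S m) * real m powr \<epsilon>)"
          by (simp add: split mult_ac)
        then show ?thesis using large[of q k] False D1 by (simp add: mult_right_mono)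
      qed
      finally show ?thesis .
    qed
  qed
  show thesis
  proof (rule that[of "D ^ B"])
    show "D ^ B \<ge> 1" using D1 by simp
    fix n :: nat assume n: "n \<ge> 1"
    have "card (S n) \<le> card {..<B}" by (rule card_mono) (auto simp: S_def)
    then have "D ^ card (S n) \<le> D ^ B" using D1 by (intro power_increasing) auto
    then show "real (card {d. d dvd n}) \<le> D ^ B * real n powr \<epsilon>"
      using main[OF n] by (meson order_trans mult_right_mono powr_ge_zero)
  qed
qed

subsection \<open>Products of fractions without cancellation\<close>

text \<open>Products over distinct sets of prime factors are distinct divisors. This lets the
  divisor bound control the number of subsets in the averaging below.\<close>

lemma two_power_card_prime_factors_le:
  fixes n :: nat
  assumes "n > 0"
  shows "2 ^ card (prime_factors n) \<le> card {d. d dvd n}"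
proof -
  have dvd: "\<Prod>T dvd n" if "T \<subseteq> prime_factors n" for T
  proof -
    have "finite T" using that finite_subset by blast
    then show ?thesis using that
    proof (induction T rule: finite_induct)
      case (insert q T)
      have "coprime q (\<Prod>T)"
        by (rule prod_coprime_right) (use insert in \<open>auto intro!: primes_coprime simp: in_prime_factors_iff\<close>)
      moreover have "q dvd n" "\<Prod>T dvd n" using insert by auto
      ultimately show ?case using insert by (simp add: divides_mult)
    qed simp
  qed
  have recover: "prime_factors (\<Prod>T) = T" if "T \<subseteq> prime_factors n" for T
  proof -
    have "finite T" using that finite_subset by blast
    moreover have "(0::nat) \<notin> (\<lambda>q. q) ` T" using that by auto
    ultimately have "prime_factors (\<Prod>T) = (\<Union>q\<in>T. prime_factors q)"
      using prime_factors_prod[of T "\<lambda>q. q"] by simp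
    also have "\<dots> = (\<Union>q\<in>T. {q})"
    proof (rule SUP_cong)
      fix q assume "q \<in> T"
      then have "prime q" using that by (auto simp: in_prime_factors_iff)
      then show "prime_factors q = {q}" by (simp add: prime_factorization_prime)
    qed simp
    finally show ?thesis by simp
  qed
  have "inj_on Prod (Pow (prime_factors n))"
    by (rule inj_on_inverseI[where g = prime_factors]) (use recover in auto)
  then have "card (Pow (prime_factors n)) \<le> card {d. d dvd n}"
    by (rule card_inj_on_le) (use dvd assms in auto)
  then show ?thesis by (simp add: card_Pow)
qed

text \<open>Averaging over all sets \<open>S\<close> of primes. Fractions whose numerators are supported on \<open>S\<close> and
  whose denominators are supported off \<open>S\<close> multiply without cancellation.\<close>

lemma obtain_prime_separation:
  fixes A :: "(nat \<times> nat) set" and D :: real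
  assumes fin: "finite A"
    and A: "\<And>x y. (x, y) \<in> A \<Longrightarrow> x > 0 \<and> y > 0 \<and> coprime x y"
    and D: "\<And>x y. (x, y) \<in> A \<Longrightarrow> real (card {d. d dvd x}) \<le> D \<and> real (card {d. d dvd y}) \<le> D"
  obtains S where "real (card A) \<le>
    D ^ 2 * real (card {(x, y) \<in> A. prime_factors x \<subseteq> S \<and> prime_factors y \<inter> S = {}})"
proof (rule ccontr)
  define good where "good S z \<longleftrightarrow> prime_factors (fst z) \<subseteq> S \<and> prime_factors (snd z) \<inter> S = {}"
    for S :: "nat set" and z :: "nat \<times> nat"
  have eq: "{(x, y) \<in> A. prime_factors x \<subseteq> S \<and> prime_factors y \<inter> S = {}} = {z \<in> A. good S z}" for S
    by (auto simp: good_def)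
  \<comment> \<open>If every \<open>S\<close> were deficient, counting the pairs of \<open>z\<close>
    in \<open>A\<close> and \<open>S \<subseteq> P\<close> with \<open>good S z\<close> in two ways
    would contradict \<open>pt\<close>. Restricting to subsets of the finite set \<open>P\<close>
    makes the average finite.\<close>
  assume "\<not> thesis"
  then have lt: "D ^ 2 * real (card {z \<in> A. good S z}) < real (card A)" for S
    using that[of S] unfolding eq by (meson not_le)
  define P where "P = (\<Union>z\<in>A. prime_factors (fst z) \<union> prime_factors (snd z))"
  have P: "finite P" using fin by (auto simp: P_def)
  have pt: "2 ^ card P \<le> D ^ 2 * real (card {S \<in> Pow P. good S z})" if z: "z \<in> A" for z
  proof -
    obtain x y where xy: "z = (x, y)" by (cases z)
    have pos: "x > 0" "y > 0" "coprime x y" using A z xy by auto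
    have disj: "prime_factors x \<inter> prime_factors y = {}"
    proof (rule equals0I)
      fix q assume "q \<in> prime_factors x \<inter> prime_factors y"
      then have "prime q" "q dvd x" "q dvd y" by (auto simp: in_prime_factors_iff)
      then show False using pos(3) coprime_common_divisor not_prime_unit by blast
    qed
    have sub: "prime_factors x \<subseteq> P" "prime_factors y \<subseteq> P"
      using z UN_upper[of z A "\<lambda>z. prime_factors (fst z) \<union> prime_factors (snd z)"]
      unfolding P_def xy by auto
    \<comment> \<open>Any \<open>S\<close> is made good for \<open>z\<close> by adding the primes of
      \<open>x\<close> and removing those of \<open>y\<close>. The two traces record what was
      changed, so \<open>S\<close> can be recovered, and a proportion of at least
      \<open>1 / D^2\<close> of all \<open>S\<close> is good for \<open>z\<close>.\<close>
    let ?f = "\<lambda>S. ((S \<union> prime_factors x) - prime_factors y, S \<inter> prime_factors x, S \<inter> prime_factors y)"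
    have "inj_on ?f (Pow P)"
      by (rule inj_onI) blast
    then have "card (Pow P) \<le>
        card ({S \<in> Pow P. good S z} \<times> (Pow (prime_factors x) \<times> Pow (prime_factors y)))"
      by (rule card_inj_on_le) (use sub disj P in \<open>auto simp: good_def xy\<close>)
    then have "2 ^ card P \<le> card {S \<in> Pow P. good S z} *
        (2 ^ card (prime_factors x) * 2 ^ card (prime_factors y))"
      using P by (simp add: card_cartesian_product card_Pow)
    also have "\<dots> \<le> card {S \<in> Pow P. good S z} * (card {d. d dvd x} * card {d. d dvd y})"
      by (intro mult_left_mono mult_mono two_power_card_prime_factors_le) (use pos in auto)
    finally have "real (2 ^ card P) \<le>
        real (card {S \<in> Pow P. good S z} * (card {d. d dvd x} * card {d. d dvd y}))"
      by (rule of_nat_mono)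
    also have "\<dots> = real (card {S \<in> Pow P. good S z}) *
        (real (card {d. d dvd x}) * real (card {d. d dvd y}))" by simp
    also have "\<dots> \<le> real (card {S \<in> Pow P. good S z}) * (D * D)"
      using D[of x y] z xy by (intro mult_left_mono mult_mono) (auto intro: order_trans[OF of_nat_0_le_iff])
    finally show ?thesis by (simp add: power2_eq_square mult_ac)
  qed
  have "2 ^ card P * real (card A) = (\<Sum>z\<in>A. 2 ^ card P)" by simp
  also have "\<dots> \<le> (\<Sum>z\<in>A. D ^ 2 * real (card {S \<in> Pow P. good S z}))"
    by (rule sum_mono) (rule pt)
  also have "\<dots> = D ^ 2 * real (\<Sum>z\<in>A. card {S \<in> Pow P. good S z})"
    by (simp add: sum_distrib_left)
  also have "(\<Sum>z\<in>A. card {S \<in> Pow P. good S z}) = (\<Sum>S\<in>Pow P. card {z \<in> A. good S z})"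
    by (rule sum_multicount_gen[symmetric]) (use fin P in auto)
  also have "D ^ 2 * real (\<Sum>S\<in>Pow P. card {z \<in> A. good S z})
      = (\<Sum>S\<in>Pow P. D ^ 2 * real (card {z \<in> A. good S z}))"
    by (simp add: sum_distrib_left)
  also have "\<dots> < (\<Sum>S\<in>Pow P. real (card A))"
    by (rule sum_strict_mono) (use P lt in auto)
  also have "\<dots> = 2 ^ card P * real (card A)" using P by (simp add: card_Pow)
  finally show False by simp
qed

section \<open>Counting fractions with a prescribed residue\<close>

text \<open>The values \<open>a/b\<close> lie in \<open>[0, 1]\<close> and differ pairwise by at
  least \<open>p / (b b') \<ge> p / N^2\<close>. After scaling by \<open>c = N^2 / p\<close> they
  are at distance at least 1, so their floors are distinct integers between 0 and the floor of
  \<open>c\<close>.\<close>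

lemma card_separated_fractions_le:
  fixes B :: "(nat \<times> nat) set" and p N :: nat
  assumes p: "p > 0"
    and B: "\<And>a b. (a, b) \<in> B \<Longrightarrow> a \<le> b \<and> 0 < b \<and> b \<le> N"
    and sep: "\<And>a b a' b'. (a, b) \<in> B \<Longrightarrow> (a', b') \<in> B \<Longrightarrow> (a, b) \<noteq> (a', b') \<Longrightarrow>
      real p \<le> \<bar>real a * real b' - real a' * real b\<bar>"
  shows "real (card B) \<le> 1 + real N ^ 2 / real p"
proof -
  define c where "c = real N ^ 2 / real p"
  have c0: "c \<ge> 0" by (simp add: c_def)
  define f where "f z = nat \<lfloor>real (fst z) / real (snd z) * c\<rfloor>" for z :: "nat \<times> nat"
  have inj: "inj_on f B"
  proof (rule inj_onI, rule ccontr)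
    fix z z' assume z: "z \<in> B" "z' \<in> B" "f z = f z'" "z \<noteq> z'"
    obtain a b a' b' where ab: "z = (a, b)" "z' = (a', b')" by (cases z; cases z')
    have b: "0 < b" "b \<le> N" "0 < b'" "b' \<le> N" using B z ab by auto
    have "\<lfloor>real a / real b * c\<rfloor> = \<lfloor>real a' / real b' * c\<rfloor>"
      using z(3) c0 by (simp add: f_def ab eq_nat_nat_iff)
    then have lt: "\<bar>real a / real b * c - real a' / real b' * c\<bar> < 1"
      by linarith
    have N: "real N ^ 2 > 0" using b by simp
    have "real b * real b' \<le> real N ^ 2"
      using b by (simp add: power2_eq_square mult_mono)
    then have "real p / real N ^ 2 \<le> real p / (real b * real b')"
      using b by (intro divide_left_mono) auto
    also have "\<dots> \<le> \<bar>real a * real b' - real a' * real b\<bar> / (real b * real b')"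
      using sep[of a b a' b'] z ab by (intro divide_right_mono) auto
    also have "\<dots> = \<bar>real a / real b - real a' / real b'\<bar>"
      using b by (simp add: diff_frac_eq abs_mult)
    finally have "real p / real N ^ 2 * c \<le> \<bar>real a / real b - real a' / real b'\<bar> * c"
      using c0 by (rule mult_right_mono)
    moreover have "real p / real N ^ 2 * c = 1"
      using p N by (simp add: c_def)
    moreover have "\<bar>real a / real b - real a' / real b'\<bar> * c
        = \<bar>real a / real b * c - real a' / real b' * c\<bar>"
      unfolding left_diff_distrib[symmetric] abs_mult using c0 by simp
    ultimately show False using lt by linarith
  qed
  have "f z \<le> nat \<lfloor>c\<rfloor>" if "z \<in> B" for z
  proof -
    obtain a b where ab: "z = (a, b)" by (cases z)
    have "real a / real b \<le> 1" using B[of a b] that ab by simp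
    then have "real a / real b * c \<le> c" using mult_right_mono[of "real a / real b" 1 c] c0 by simp
    then show ?thesis by (simp add: f_def ab floor_mono nat_mono)
  qed
  then have "card B \<le> card {..nat \<lfloor>c\<rfloor>}"
    by (intro card_inj_on_le[OF inj]) auto
  then have "real (card B) \<le> 1 + real (nat \<lfloor>c\<rfloor>)" by simp
  also have "\<dots> \<le> 1 + c" using c0 by simp
  finally show ?thesis by (simp add: c_def)
qed

text \<open>For \<open>V = U\<close> this is the set \<open>A(h)\<close>. The set \<open>V\<close>
  is a parameter because single residues and iterated products are needed as well. The residue is
  only required to exist, so fractions are counted.\<close>

definition reduced_solutions :: "nat \<Rightarrow> nat \<Rightarrow> int set \<Rightarrow> (nat \<times> nat) set" where
  "reduced_solutions p h V = {(x, y). x \<in> {1..h} \<and> y \<in> {1..h} \<and> coprime x y \<and>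
     (\<exists>r\<in>V. [int x = int y * r] (mod int p))}"

lemma finite_reduced_solutions [simp]: "finite (reduced_solutions p h V)"
  by (rule finite_subset[of _ "{1..h} \<times> {1..h}"]) (auto simp: reduced_solutions_def)

lemma coprime_cross_mult_eq:
  fixes a b a' b' :: nat
  assumes "coprime a b" "coprime a' b'" "a * b' = a' * b"
  shows "a = a' \<and> b = b'"
proof -
  have "a dvd a'" "a' dvd a" "b dvd b'" "b' dvd b"
    using assms by (metis coprime_commute coprime_dvd_mult_left_iff coprime_dvd_mult_right_iff dvd_triv_left dvd_triv_right)+
  then show ?thesis by (simp add: dvd_antisym)
qed

text \<open>For two distinct reduced fractions with residue \<open>r\<close> the cross determinant
  is divisible by \<open>p\<close> and nonzero, hence at least \<open>p\<close> in absolute value.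
  Fractions above 1 are inverted before the separation bound is applied, which accounts for the
  factor 2.\<close>

lemma card_reduced_solutions_singleton_le:
  fixes p N :: nat
  assumes p: "p > 0"
  shows "real (card (reduced_solutions p N {r})) \<le> 2 * (1 + real N ^ 2 / real p)"
proof -
  let ?L = "reduced_solutions p N {r}"
  define B1 where "B1 = {(x, y) \<in> ?L. x \<le> y}"
  define B2 where "B2 = {(y, x). (x, y) \<in> ?L \<and> y \<le> x}"
  have sep: "real p \<le> \<bar>real a * real b' - real a' * real b\<bar>"
    if "(a, b) \<in> ?L" "(a', b') \<in> ?L" "(a, b) \<noteq> (a', b')" for a b a' b'
  proof -
    have cop: "coprime a b" "coprime a' b'"
      and cg: "[int a = int b * r] (mod int p)" "[int a' = int b' * r] (mod int p)"
      using that by (auto simp: reduced_solutions_def)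
    have "[int a * int b' = (int b * r) * int b'] (mod int p)"
      using cg by (intro cong_mult) auto
    moreover have "[int a' * int b = (int b' * r) * int b] (mod int p)"
      using cg by (intro cong_mult) auto
    ultimately have "[int a * int b' = int a' * int b] (mod int p)"
      by (metis cong_sym cong_trans mult.assoc mult.commute mult.left_commute)
    then have "int p dvd int a * int b' - int a' * int b"
      by (simp add: cong_iff_dvd_diff)
    moreover have "int a * int b' - int a' * int b \<noteq> 0"
      using coprime_cross_mult_eq[OF cop] that(3) by (simp flip: of_nat_mult) blast
    ultimately have "int p \<le> \<bar>int a * int b' - int a' * int b\<bar>"
      using dvd_imp_le_int[of "int a * int b' - int a' * int b" "int p"] by simp
    then have "real_of_int (int p) \<le> real_of_int \<bar>int a * int b' - int a' * int b\<bar>"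
      by (simp only: of_int_le_iff)
    then show ?thesis by simp
  qed
  have 1: "real (card B1) \<le> 1 + real N ^ 2 / real p"
    by (rule card_separated_fractions_le[OF p]) (use sep in \<open>auto simp: B1_def reduced_solutions_def\<close>)
  have 2: "real (card B2) \<le> 1 + real N ^ 2 / real p"
  proof (rule card_separated_fractions_le[OF p])
    fix a b a' b' assume "(a, b) \<in> B2" "(a', b') \<in> B2" "(a, b) \<noteq> (a', b')"
    then show "real p \<le> \<bar>real a * real b' - real a' * real b\<bar>"
      using sep[of b a b' a'] by (auto simp: B2_def mult.commute abs_minus_commute)
  qed (auto simp: B2_def reduced_solutions_def)
  have "?L \<subseteq> B1 \<union> prod.swap ` B2" by (force simp: B1_def B2_def)
  moreover have "finite B1" "finite B2"
  proof -
    show "finite B1" unfolding B1_def by (rule finite_subset[of _ ?L]) auto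
    have "B2 \<subseteq> prod.swap ` ?L" by (force simp: B2_def)
    then show "finite B2" by (rule finite_subset) auto
  qed
  ultimately have "card ?L \<le> card (B1 \<union> prod.swap ` B2)" by (intro card_mono) auto
  also have "\<dots> \<le> card B1 + card (prod.swap ` B2)" by (rule card_Un_le)
  also have "card (prod.swap ` B2) = card B2" by (rule card_image) auto
  finally have "real (card ?L) \<le> real (card B1) + real (card B2)" by linarith
  then show ?thesis using 1 2 by simp
qed

lemma card_reduced_solutions_le:
  fixes p N :: nat
  assumes p: "p > 0" and V: "finite V"
  shows "real (card (reduced_solutions p N V)) \<le> 2 * real (card V) * (1 + real N ^ 2 / real p)"
proof -
  have "reduced_solutions p N V = (\<Union>r\<in>V. reduced_solutions p N {r})"
    by (auto simp: reduced_solutions_def)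
  then have "card (reduced_solutions p N V) \<le> (\<Sum>r\<in>V. card (reduced_solutions p N {r}))"
    using card_UN_le[OF V] by metis
  then have "real (card (reduced_solutions p N V)) \<le> (\<Sum>r\<in>V. real (card (reduced_solutions p N {r})))"
    by (metis of_nat_le_iff of_nat_sum)
  also have "\<dots> \<le> (\<Sum>r\<in>V. 2 * (1 + real N ^ 2 / real p))"
    by (rule sum_mono) (rule card_reduced_solutions_singleton_le[OF p])
  finally show ?thesis by (simp add: algebra_simps)
qed

section \<open>Products of \<open>m\<close> fractions and the moment bound\<close>

text \<open>This is \<open>U^m\<close>, written as an iteration starting from the identity so that
  it matches \<open>card_iterated_set_mult_le\<close>.\<close>

definition iterated_product :: "nat \<Rightarrow> int set \<Rightarrow> nat \<Rightarrow> int set" where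
  "iterated_product p U m =
     ((<#>\<^bsub>residue_ring (int p)\<^esub>) U ^^ m) {\<one>\<^bsub>residue_ring (int p)\<^esub>}"

lemma
  assumes p: "prime p" and U: "small_doubling p U"
  shows small_doubling_finite: "finite U"
    and small_doubling_card_pos: "card U > 0"
    and small_doubling_subset: "U \<subseteq> {1..<int p}"
    and finite_iterated_product: "finite (iterated_product p U m)"
    and card_iterated_product_le: "card (iterated_product p U m) \<le> 10 ^ m * card U"
proof -
  interpret residues_prime p "residue_ring (int p)"
    by (simp add: residues_prime_def p)
  let ?R = "residue_ring (int p)"
  show sub: "U \<subseteq> {1..<int p}"
    using U by (force simp: small_doubling_def res_units_eq)
  then show fin: "finite U" by (rule finite_subset) auto
  show pos: "card U > 0"
    using U by (auto simp: small_doubling_def)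
  \<comment> \<open>The growth estimate needs a commutative group. Passing to the unit group changes
    only the carrier, so set products and the identity stay the same.\<close>
  have sm: "set_mult (units_of ?R) = set_mult ?R"
    by (intro ext) (simp add: set_mult_def units_of_mult)
  have eq: "iterated_product p U m = ((<#>\<^bsub>units_of ?R\<^esub>) U ^^ m) {\<one>\<^bsub>units_of ?R\<^esub>}" for m
    unfolding iterated_product_def sm units_of_one ..
  show "finite (iterated_product p U m)"
  proof (induction m)
    case (Suc m)
    have "iterated_product p U (Suc m) = U <#>\<^bsub>?R\<^esub> iterated_product p U m"
      by (simp add: iterated_product_def)
    then show ?case using Suc fin by (simp add: set_mult_def)
  qed (simp add: iterated_product_def)
  show "card (iterated_product p U m) \<le> 10 ^ m * card U"
    unfolding eq
  proof (rule comm_group.card_iterated_set_mult_le)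
    show "comm_group (units_of ?R)" by (rule units_comm_group)
  qed (use U fin pos in \<open>auto simp: small_doubling_def units_of_carrier sm\<close>)
qed

lemma iterated_product_Suc:
  assumes "r \<in> U" "s \<in> iterated_product p U m"
  shows "(r * s) mod int p \<in> iterated_product p U (Suc m)"
proof -
  have "iterated_product p U (Suc m) = U <#>\<^bsub>residue_ring (int p)\<^esub> iterated_product p U m"
    by (simp add: iterated_product_def)
  also have "\<dots> = (\<Union>r\<in>U. \<Union>s\<in>iterated_product p U m. {(r * s) mod int p})"
    by (simp add: set_mult_def residue_ring_def)
  finally show ?thesis using assms by blast
qed

text \<open>Multiply \<open>m\<close>-tuples from \<open>A\<close> coordinatewise. Numerators stay
  supported on \<open>S\<close> and denominators off \<open>S\<close>, so each product is reduced,
  has height at most \<open>h^m\<close> and has its residue in \<open>U^m\<close>. Every coordinate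
  of a tuple divides the product, so a product \<open>(X, Y)\<close> comes from at most
  \<open>(d(X) d(Y))^m \<le> D^(2 m)\<close> tuples, where \<open>d\<close> counts divisors.\<close>

lemma card_power_separated_le:
  fixes p h m :: nat and D :: real
  assumes p: "prime p" and U: "small_doubling p U"
    and A: "A \<subseteq> reduced_solutions p h U"
    and S: "\<And>x y. (x, y) \<in> A \<Longrightarrow> prime_factors x \<subseteq> S \<and> prime_factors y \<inter> S = {}"
    and D: "\<And>k. 1 \<le> k \<Longrightarrow> k \<le> h ^ m \<Longrightarrow> real (card {d. d dvd k}) \<le> D"
  shows "real (card A) ^ m
    \<le> D ^ (2 * m) * real (card (reduced_solutions p (h ^ m) (iterated_product p U m)))"
proof -
  define L where "L = {zs. set zs \<subseteq> A \<and> length zs = m}"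
  define R where "R = reduced_solutions p (h ^ m) (iterated_product p U m)"
  define \<phi> where "\<phi> zs = (prod_list (map fst zs), prod_list (map snd zs))" for zs :: "(nat \<times> nat) list"
  have finA: "finite A" using A finite_subset by fastforce
  have products: "fst (\<phi> zs) \<in> {1..h ^ length zs} \<and> snd (\<phi> zs) \<in> {1..h ^ length zs} \<and>
      prime_factors (fst (\<phi> zs)) \<subseteq> S \<and> prime_factors (snd (\<phi> zs)) \<inter> S = {} \<and>
      (\<exists>r\<in>iterated_product p U (length zs). [int (fst (\<phi> zs)) = int (snd (\<phi> zs)) * r] (mod int p))"
    if "set zs \<subseteq> A" for zs
    using that
  proof (induction zs)
    case Nil
    then show ?case by (auto simp: \<phi>_def iterated_product_def residue_ring_def)
  next
    case (Cons z zs)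
    obtain x y where z: "z = (x, y)" by (cases z)
    define X Y where "X = fst (\<phi> zs)" and "Y = snd (\<phi> zs)"
    have \<phi>: "fst (\<phi> (z # zs)) = x * X" "snd (\<phi> (z # zs)) = y * Y"
      by (simp_all add: \<phi>_def X_def Y_def z)
    have zA: "(x, y) \<in> A" using Cons z by auto
    then have "(x, y) \<in> reduced_solutions p h U" using A by auto
    then obtain r where xy: "x \<in> {1..h}" "y \<in> {1..h}" "r \<in> U" "[int x = int y * r] (mod int p)"
      by (auto simp: reduced_solutions_def)
    obtain s where XY: "X \<in> {1..h ^ length zs}" "Y \<in> {1..h ^ length zs}"
      "prime_factors X \<subseteq> S" "prime_factors Y \<inter> S = {}"
      "s \<in> iterated_product p U (length zs)" "[int X = int Y * s] (mod int p)"
      using Cons unfolding X_def Y_def by auto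
    have "[int x * int X = (int y * r) * (int Y * s)] (mod int p)"
      using xy XY by (intro cong_mult)
    also have "(int y * r) * (int Y * s) = int (y * Y) * (r * s)" by simp
    \<comment> \<open>Iterated products consist of reduced representatives, so \<open>r * s\<close>
      has to be replaced by its remainder.\<close>
    also have "[int (y * Y) * (r * s) = int (y * Y) * ((r * s) mod int p)] (mod int p)"
      by (intro cong_mult) auto
    finally have cg: "[int (x * X) = int (y * Y) * ((r * s) mod int p)] (mod int p)" by simp
    have "prime_factors (x * X) = prime_factors x \<union> prime_factors X"
      "prime_factors (y * Y) = prime_factors y \<union> prime_factors Y"
      using xy XY by (intro prime_factors_product; simp)+
    then have pf: "prime_factors (x * X) \<subseteq> S" "prime_factors (y * Y) \<inter> S = {}"
      using S[OF zA] XY by auto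
    have "x * X \<in> {1..h ^ length (z # zs)}" "y * Y \<in> {1..h ^ length (z # zs)}"
      using xy XY by (auto intro: mult_mono simp: Suc_le_eq)
    then show ?case unfolding \<phi>
      using pf cg iterated_product_Suc[OF xy(3) XY(5)] by auto
  qed
  have \<phi>R: "\<phi> zs \<in> R" if "zs \<in> L" for zs
  proof -
    obtain X Y where XY: "\<phi> zs = (X, Y)" by (cases "\<phi> zs")
    have zs: "set zs \<subseteq> A" "length zs = m" using that by (auto simp: L_def)
    note pr = products[OF zs(1), unfolded XY zs(2) fst_conv snd_conv]
    have "coprime X Y"
    proof (rule ccontr)
      assume "\<not> coprime X Y"
      then obtain q where q: "prime q" "q dvd X" "q dvd Y"
        by (metis coprime_iff_gcd_eq_1 gcd_dvd1 gcd_dvd2 dvd_trans prime_factor_nat)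
      then have "q \<in> prime_factors X" "q \<in> prime_factors Y"
        using pr by (auto simp: in_prime_factors_iff)
      then show False using pr by auto
    qed
    then show ?thesis using pr unfolding R_def XY by (simp add: reduced_solutions_def)
  qed
  have fibre: "real (card {zs \<in> L. \<phi> zs = z}) \<le> D ^ (2 * m)" if "z \<in> R" for z
  proof -
    obtain X Y where z: "z = (X, Y)" by (cases z)
    have XY: "1 \<le> X" "X \<le> h ^ m" "1 \<le> Y" "Y \<le> h ^ m"
      using that by (auto simp: R_def z reduced_solutions_def)
    let ?E = "{d. d dvd X} \<times> {d. d dvd Y}"
    have finE: "finite ?E" using XY by auto
    have "{zs \<in> L. \<phi> zs = z} \<subseteq> {zs. set zs \<subseteq> ?E \<and> length zs = m}"
    proof
      fix zs assume zs: "zs \<in> {zs \<in> L. \<phi> zs = z}"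
      have "w \<in> ?E" if "w \<in> set zs" for w
      proof -
        have "fst w dvd prod_list (map fst zs)" "snd w dvd prod_list (map snd zs)"
          using that by (simp_all add: prod_list_dvd)
        then show ?thesis using zs z by (simp add: \<phi>_def mem_Times_iff)
      qed
      then show "zs \<in> {zs. set zs \<subseteq> ?E \<and> length zs = m}"
        using zs by (auto simp: L_def)
    qed
    then have "card {zs \<in> L. \<phi> zs = z} \<le> card {zs. set zs \<subseteq> ?E \<and> length zs = m}"
      by (intro card_mono finite_lists_length_eq finE)
    also have "\<dots> = card ?E ^ m" by (rule card_lists_length_eq[OF finE])
    finally have "real (card {zs \<in> L. \<phi> zs = z}) \<le> real (card ?E ^ m)" by (rule of_nat_mono)
    also have "\<dots> = (real (card {d. d dvd X}) * real (card {d. d dvd Y})) ^ m"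
      by (simp add: card_cartesian_product)
    also have "\<dots> \<le> (D * D) ^ m"
      using D[of X] D[of Y] XY
      by (intro power_mono mult_mono) (auto intro: order_trans[OF of_nat_0_le_iff])
    finally show ?thesis by (simp add: power_mult power2_eq_square)
  qed
  have finL: "finite L" unfolding L_def by (rule finite_lists_length_eq[OF finA])
  have finR: "finite R" by (simp add: R_def)
  have "card L \<le> card (\<Union>z\<in>R. {zs \<in> L. \<phi> zs = z})"
    by (rule card_mono) (use \<phi>R finR finL in auto)
  also have "\<dots> \<le> (\<Sum>z\<in>R. card {zs \<in> L. \<phi> zs = z})"
    by (rule card_UN_le[OF finR])
  finally have "real (card L) \<le> real (\<Sum>z\<in>R. card {zs \<in> L. \<phi> zs = z})"
    by (rule of_nat_mono)
  also have "\<dots> = (\<Sum>z\<in>R. real (card {zs \<in> L. \<phi> zs = z}))" by simp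
  also have "\<dots> \<le> (\<Sum>z\<in>R. D ^ (2 * m))" by (rule sum_mono) (rule fibre)
  finally have "real (card L) \<le> D ^ (2 * m) * real (card R)" by (simp add: mult.commute)
  moreover have "card L = card A ^ m" unfolding L_def by (rule card_lists_length_eq[OF finA])
  ultimately show ?thesis by (simp add: R_def)
qed

lemma reduced_solutions_moment_bound:
  fixes m :: nat and \<eta> :: real
  assumes m: "m \<ge> 1" and \<eta>: "\<eta> > 0"
  obtains c :: real where "c \<ge> 1"
    "\<And>p h U. prime p \<Longrightarrow> h < p \<Longrightarrow> small_doubling p U \<Longrightarrow>
       real (card (reduced_solutions p h U)) ^ m
         \<le> c * real p powr \<eta> * (real (card U) * (1 + real h ^ (2 * m) / real p))"
proof -
  \<comment> \<open>With \<open>D = C p^(m \<epsilon>)\<close> the final factor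
    \<open>D^(4 m)\<close> contributes \<open>p^(4 m^2 \<epsilon>)\<close>, which is
    \<open>p^\<eta>\<close>.\<close>
  define \<epsilon> where "\<epsilon> = \<eta> / (4 * real m ^ 2)"
  have \<epsilon>: "\<epsilon> > 0" using m \<eta> by (simp add: \<epsilon>_def)
  obtain C :: real where C: "C \<ge> 1"
    "\<And>n::nat. n \<ge> 1 \<Longrightarrow> real (card {d. d dvd n}) \<le> C * real n powr \<epsilon>"
    using divisor_bound[OF \<epsilon>] by blast
  \<comment> \<open>\<open>C^(4 m)\<close> collects the losses of the prime separation and of the
    tuple count, \<open>D^(2 m)\<close> each; \<open>10^m\<close> comes from the growth of
    \<open>U^m\<close>, and 2 from counting fractions per residue.\<close>
  define c where "c = C ^ (4 * m) * 10 ^ m * 2"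
  show thesis
  proof (rule that[of c])
    show "c \<ge> 1"
    proof -
      have "1 * 1 \<le> C ^ (4 * m) * (10::real) ^ m" using C by (intro mult_mono) auto
      then show ?thesis by (simp add: c_def)
    qed
    fix p h :: nat and U :: "int set"
    assume p: "prime p" and h: "h < p" and U: "small_doubling p U"
    have p0: "p > 0" using p prime_gt_0_nat by auto
    define D where "D = C * real p powr (real m * \<epsilon>)"
    have D: "real (card {d. d dvd k}) \<le> D" if "1 \<le> k" "k \<le> p ^ m" for k
    proof -
      have "real k \<le> real (p ^ m)" using that by simp
      then have "real k powr \<epsilon> \<le> real (p ^ m) powr \<epsilon>" using \<epsilon> by (intro powr_mono2) auto
      also have "\<dots> = real p powr (real m * \<epsilon>)"
        using p0 by (simp add: powr_powr flip: powr_realpow)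
      finally show ?thesis using C(2)[OF that(1)] C(1) unfolding D_def
        by (meson mult_left_mono order_trans zero_le_one)
    qed
    \<comment> \<open>One \<open>D\<close>, valid up to \<open>p^m\<close>, serves both the
      fractions themselves and their \<open>m\<close>-fold products.\<close>
    have hm: "h ^ m \<le> p ^ m" using h by (intro power_mono) auto
    have hp: "h \<le> p ^ m" using h m p0 power_increasing[of 1 m p] by simp
    let ?A = "reduced_solutions p h U"
    have A: "x > 0 \<and> y > 0 \<and> coprime x y \<and> x \<le> h \<and> y \<le> h" if "(x, y) \<in> ?A" for x y
      using that by (auto simp: reduced_solutions_def)
    obtain S where S: "real (card ?A) \<le>
      D ^ 2 * real (card {(x, y) \<in> ?A. prime_factors x \<subseteq> S \<and> prime_factors y \<inter> S = {}})"
    proof (rule obtain_prime_separation[of ?A D])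
      fix x y assume "(x, y) \<in> ?A"
      then show "real (card {d. d dvd x}) \<le> D \<and> real (card {d. d dvd y}) \<le> D"
        using D[of x] D[of y] A[of x y] hp by auto
    qed (use A in auto)
    define A' where "A' = {(x, y) \<in> ?A. prime_factors x \<subseteq> S \<and> prime_factors y \<inter> S = {}}"
    have D0: "D \<ge> 0" using C by (simp add: D_def)
    have "real (card ?A) ^ m \<le> (D ^ 2 * real (card A')) ^ m"
      using S unfolding A'_def by (intro power_mono) auto
    also have "\<dots> = D ^ (2 * m) * real (card A') ^ m" by (simp add: power_mult_distrib power_mult)
    also have "real (card A') ^ m
        \<le> D ^ (2 * m) * real (card (reduced_solutions p (h ^ m) (iterated_product p U m)))"
      by (rule card_power_separated_le[OF p U, where S = S])
        (use D hm in \<open>auto simp: A'_def\<close>)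
    also have "real (card (reduced_solutions p (h ^ m) (iterated_product p U m)))
        \<le> 2 * real (card (iterated_product p U m)) * (1 + real (h ^ m) ^ 2 / real p)"
      by (rule card_reduced_solutions_le[OF p0 finite_iterated_product[OF p U]])
    also have "real (card (iterated_product p U m)) \<le> real (10 ^ m * card U)"
      by (rule of_nat_mono[OF card_iterated_product_le[OF p U]])
    finally have "real (card ?A) ^ m
        \<le> D ^ (2 * m) * (D ^ (2 * m) * (2 * real (10 ^ m * card U) * (1 + real (h ^ m) ^ 2 / real p)))"
      using D0 by (simp add: mult_left_mono mult_right_mono)
    also have "\<dots> = D ^ (4 * m) * 10 ^ m * 2 * (real (card U) * (1 + real h ^ (2 * m) / real p))"
    proof -
      have "D ^ (4 * m) = D ^ (2 * m) * D ^ (2 * m)" by (simp flip: power_add)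
      moreover have "real h ^ (2 * m) = real (h ^ m) ^ 2" by (simp flip: power_mult add: mult.commute)
      ultimately show ?thesis by (simp add: mult_ac)
    qed
    also have "D ^ (4 * m) = C ^ (4 * m) * real p powr \<eta>"
    proof -
      have "(real p powr (real m * \<epsilon>)) ^ (4 * m) = real p powr (real m * \<epsilon> * real (4 * m))"
        using p0 by (simp add: powr_powr flip: powr_realpow)
      also have "real m * \<epsilon> * real (4 * m) = \<eta>"
        using m by (simp add: \<epsilon>_def power2_eq_square field_simps)
      finally show ?thesis by (simp add: D_def power_mult_distrib)
    qed
    finally show "real (card ?A) ^ m
         \<le> c * real p powr \<eta> * (real (card U) * (1 + real h ^ (2 * m) / real p))"
      by (simp add: c_def mult_ac)
  qed
qed

subsection \<open>Reduced solutions\<close>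

text \<open>The \<open>m\<close>-th root of the moment bound, with a free target \<open>B\<close>.
  The 2 in the hypothesis leaves room to bound \<open>|U|\<close> and \<open>|U| h^(2 m) / p\<close>
  by \<open>B^m\<close> separately. The constant is quantified existentially so that constants for
  all \<open>m\<close> can be chosen as one function.\<close>

lemma reduced_solutions_root_bound:
  fixes m :: nat and \<eta> :: real
  assumes m: "m \<ge> 1" and \<eta>: "\<eta> > 0"
  shows "\<exists>c::real. c \<ge> 1 \<and> (\<forall>p h U B. prime p \<longrightarrow> h < p \<longrightarrow> small_doubling p U \<longrightarrow> B \<ge> 0 \<longrightarrow>
       real (card U) * (1 + real h ^ (2 * m) / real p) \<le> 2 * B ^ m \<longrightarrow>
       real (card (reduced_solutions p h U)) \<le> c * real p powr \<eta> * B)"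
proof -
  obtain c :: real where c: "c \<ge> 1"
    "\<And>p h U. prime p \<Longrightarrow> h < p \<Longrightarrow> small_doubling p U \<Longrightarrow>
       real (card (reduced_solutions p h U)) ^ m
         \<le> c * real p powr \<eta> * (real (card U) * (1 + real h ^ (2 * m) / real p))"
    using reduced_solutions_moment_bound[OF m \<eta>] by blast
  have "real (card (reduced_solutions p h U)) \<le> (2 * c) * real p powr \<eta> * B"
    if p: "prime p" and h: "h < p" and U: "small_doubling p U" and B: "B \<ge> 0"
      and le: "real (card U) * (1 + real h ^ (2 * m) / real p) \<le> 2 * B ^ m" for p h U B
  proof -
    define t where "t = 2 * c * real p powr \<eta>"
    have "1 * 1 \<le> c * real p powr \<eta>"
      using c(1) \<eta> prime_ge_1_nat[OF p] by (intro mult_mono) (auto simp: ge_one_powr_ge_zero)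
    then have t: "t \<ge> 1" by (simp add: t_def)
    have "real (card (reduced_solutions p h U)) ^ m \<le> c * real p powr \<eta> * (2 * B ^ m)"
      using c(2)[OF p h U] le c(1)
      by (meson order_trans mult_left_mono mult_nonneg_nonneg powr_ge_zero zero_le_one)
    also have "\<dots> = t * B ^ m" by (simp add: t_def)
    also have "\<dots> \<le> t ^ m * B ^ m"
      using t m B by (intro mult_right_mono) (auto intro: self_le_power)
    also have "\<dots> = (t * B) ^ m" by (simp add: power_mult_distrib)
    finally show ?thesis
      using t m B by (simp add: t_def power_mono_iff)
  qed
  moreover have "2 * c \<ge> 1" using c by simp
  ultimately show ?thesis by blast
qed

lemma card_reduced_solutions_le_square: "card (reduced_solutions p h U) \<le> h * h"
proof -
  have "card (reduced_solutions p h U) \<le> card ({1..h} \<times> {1..h})"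
    by (rule card_mono) (auto simp: reduced_solutions_def)
  then show ?thesis by simp
qed

lemma powr_frac_power:
  fixes k :: nat
  assumes "x > (0::real)"
  shows "(x powr (real k / (2 * real k + 1))) ^ (2 * k + 1) = x powr real k"
proof -
  have "(x powr (real k / (2 * real k + 1))) ^ (2 * k + 1)
      = x powr (real k / (2 * real k + 1) * real (2 * k + 1))"
    using assms by (subst powr_realpow[symmetric]) (simp_all add: powr_powr)
  also have "real k / (2 * real k + 1) * real (2 * k + 1) = real k"
    by (simp add: field_simps)
  finally show ?thesis .
qed

text \<open>The exponent \<open>m\<close> is the least one with \<open>m \<ge> n\<close> and \<open>|U| \<le> h ^ m\<close>; the size condition on
  \<open>U\<close> then forces \<open>|U| * h ^ m \<le> p\<close>, so the moment bound reads \<open>|A| ^ m \<lesssim> h ^ m\<close>.\<close>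

lemma reduced_solutions_linear_bound:
  fixes n :: nat and \<eta> :: real
  assumes n: "n \<ge> 1" and \<eta>: "\<eta> > 0"
  obtains c :: real where "c \<ge> 1"
    "\<And>p h U. prime p \<Longrightarrow> 1 \<le> h \<Longrightarrow> h < p \<Longrightarrow> small_doubling p U \<Longrightarrow>
       real (card U) < real p powr (real n / (2 * real n + 1)) \<Longrightarrow> card U * h ^ n < p \<Longrightarrow>
       real (card (reduced_solutions p h U)) \<le> c * real p powr \<eta> * real h"
proof -
  have "\<forall>m. \<exists>c::real. m \<ge> 1 \<longrightarrow> c \<ge> 1 \<and>
     (\<forall>p h U B. prime p \<longrightarrow> h < p \<longrightarrow> small_doubling p U \<longrightarrow> B \<ge> 0 \<longrightarrow>
       real (card U) * (1 + real h ^ (2 * m) / real p) \<le> 2 * B ^ m \<longrightarrow>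
       real (card (reduced_solutions p h U)) \<le> c * real p powr \<eta> * B)"
    using reduced_solutions_root_bound \<eta> by blast
  then obtain f :: "nat \<Rightarrow> real" where f: "\<And>m. m \<ge> 1 \<Longrightarrow> f m \<ge> 1"
    "\<And>m p h U B. m \<ge> 1 \<Longrightarrow> prime p \<Longrightarrow> h < p \<Longrightarrow> small_doubling p U \<Longrightarrow> B \<ge> 0 \<Longrightarrow>
       real (card U) * (1 + real h ^ (2 * m) / real p) \<le> 2 * B ^ m \<Longrightarrow>
       real (card (reduced_solutions p h U)) \<le> f m * real p powr \<eta> * B"
    by metis
  \<comment> \<open>\<open>M\<close> bounds the exponent \<open>m\<close> independently of
    \<open>p\<close> and \<open>h\<close>: once \<open>h > p^\<eta>\<close>, already
    \<open>h^M \<ge> p \<ge> |U|\<close>. Hence summing \<open>f\<close> over \<open>{1..M}\<close>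
    gives a constant depending only on \<open>n\<close> and \<open>\<eta>\<close>.\<close>
  define M where "M = max n (nat \<lceil>1 / \<eta>\<rceil>)"
  define c where "c = 1 + (\<Sum>m\<in>{1..M}. f m)"
  have fc: "f m \<le> c" if "1 \<le> m" "m \<le> M" for m
  proof -
    have "f m \<le> (\<Sum>m\<in>{1..M}. f m)"
    proof (rule member_le_sum)
      fix k assume "k \<in> {1..M} - {m}"
      then show "0 \<le> f k" using f(1)[of k] by simp
    qed (use that in auto)
    then show ?thesis by (simp add: c_def)
  qed
  have c1: "c \<ge> 1"
  proof -
    have "(\<Sum>m\<in>{1..M}. f m) \<ge> 0"
    proof (rule sum_nonneg)
      fix k assume "k \<in> {1..M}"
      then show "0 \<le> f k" using f(1)[of k] by simp
    qed
    then show ?thesis by (simp add: c_def)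
  qed
  show thesis
  proof (rule that[OF c1])
    fix p h :: nat and U :: "int set"
    assume p: "prime p" and h1: "1 \<le> h" and h: "h < p" and U: "small_doubling p U"
      and Up: "real (card U) < real p powr (real n / (2 * real n + 1))" and Uh: "card U * h ^ n < p"
    have p1: "real p \<ge> 1" using prime_ge_1_nat[OF p] by simp
    let ?A = "reduced_solutions p h U"
    show "real (card ?A) \<le> c * real p powr \<eta> * real h"
    proof (cases "real h \<le> real p powr \<eta>")
      \<comment> \<open>For tiny \<open>h\<close> the trivial count \<open>h^2\<close>
        suffices.\<close>
      case True
      have "real (card ?A) \<le> real (h * h)" by (rule of_nat_mono[OF card_reduced_solutions_le_square])
      also have "\<dots> = real h * real h" by simp
      also have "\<dots> \<le> (1 * real p powr \<eta>) * real h"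
        using True by (intro mult_right_mono) auto
      also have "\<dots> \<le> (c * real p powr \<eta>) * real h"
        using c1 by (intro mult_right_mono) auto
      finally show ?thesis .
    next
      case False
      have up: "card U \<le> p"
      proof -
        have "card U * 1 \<le> card U * h ^ n" using h1 by (intro mult_left_mono) auto
        then show ?thesis using Uh by linarith
      qed
      have "n \<le> M \<and> card U \<le> h ^ M"
      proof
        show "n \<le> M" by (simp add: M_def)
        have "real M \<ge> 1 / \<eta>" unfolding M_def by linarith
        then have "\<eta> * real M \<ge> 1" using \<eta> by (simp add: field_simps)
        then have "real p powr 1 \<le> real p powr (\<eta> * real M)"
          using p1 by (intro powr_mono) auto
        also have "\<dots> = (real p powr \<eta>) ^ M"
          using p1 by (simp add: powr_powr flip: powr_realpow)
        also have "\<dots> \<le> real h ^ M" using False by (intro power_mono) auto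
        finally have "real p \<le> real (h ^ M)" using p1 by simp
        then have "p \<le> h ^ M" by (simp only: of_nat_le_iff)
        then show "card U \<le> h ^ M" using up by simp
      qed
      then obtain m where m: "n \<le> m" "card U \<le> h ^ m" "m \<le> M"
        and least: "\<And>k. k < m \<Longrightarrow> \<not> (n \<le> k \<and> card U \<le> h ^ k)"
        using LeastI[of "\<lambda>m. n \<le> m \<and> card U \<le> h ^ m" M]
          Least_le[of "\<lambda>m. n \<le> m \<and> card U \<le> h ^ m" M] not_less_Least by blast
      have prod: "card U * h ^ m \<le> p"
      proof (cases "m = n")
        case True
        then show ?thesis using Uh by simp
      next
        case False
        \<comment> \<open>Minimality of \<open>m\<close> gives \<open>h^k < |U|\<close>. Since
          \<open>n/(2n+1)\<close> increases with \<open>n\<close>, the size condition gives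
          \<open>|U|^(2k+1) \<le> p^k\<close>. Then
          \<open>(|U| h^m)^k = |U|^k (h^k)^(k+1) \<le> |U|^(2k+1) \<le> p^k\<close>, and the
          \<open>k\<close>-th root is taken.\<close>
        define k where "k = m - 1"
        have k: "m = Suc k" "n \<le> k" "k \<ge> 1" using False m n by (auto simp: k_def)
        have hk: "h ^ k < card U" using least[of k] k by simp
        have "real n / (2 * real n + 1) \<le> real k / (2 * real k + 1)"
          using k by (simp add: field_simps)
        then have "real p powr (real n / (2 * real n + 1)) \<le> real p powr (real k / (2 * real k + 1))"
          using p1 by (intro powr_mono) auto
        then have "real (card U) ^ (2 * k + 1) \<le> (real p powr (real k / (2 * real k + 1))) ^ (2 * k + 1)"
          using Up by (intro power_mono) auto
        also have "\<dots> = real p powr real k" using p1 by (intro powr_frac_power) auto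
        also have "\<dots> = real (p ^ k)" using p1 by (simp add: powr_realpow)
        finally have "real (card U ^ (2 * k + 1)) \<le> real (p ^ k)" by (simp only: of_nat_power)
        then have Uk: "card U ^ (2 * k + 1) \<le> p ^ k" by (simp only: of_nat_le_iff)
        have "(card U * h ^ m) ^ k = card U ^ k * (h ^ k) ^ Suc k"
          by (simp add: k power_mult_distrib flip: power_mult)
        also have "\<dots> \<le> card U ^ k * card U ^ Suc k"
          using hk by (intro mult_left_mono power_mono) auto
        also have "\<dots> = card U ^ (2 * k + 1)"
          by (simp flip: power_add add: mult_2)
        also have "\<dots> \<le> p ^ k" by (rule Uk)
        finally show ?thesis using k by (simp add: power_mono_iff)
      qed
      have "real (card U) * (1 + real h ^ (2 * m) / real p) \<le> 2 * real h ^ m"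
      proof -
        have "real (card U) \<le> real h ^ m" using m(2) by (simp flip: of_nat_power)
        moreover have "real (card U) * (real h ^ (2 * m) / real p) \<le> real h ^ m"
        proof -
          have "real (card U * h ^ m) \<le> real p" using prod by (simp only: of_nat_le_iff)
          then have "real (card U) * real h ^ m / real p \<le> 1" using p1 by simp
          then have "(real (card U) * real h ^ m / real p) * real h ^ m \<le> 1 * real h ^ m"
            by (rule mult_right_mono) simp
          moreover have "real h ^ (2 * m) = real h ^ m * real h ^ m" by (simp add: mult_2 power_add)
          ultimately show ?thesis by (simp add: mult_ac)
        qed
        ultimately show ?thesis unfolding distrib_left by linarith
      qed
      then have "real (card ?A) \<le> f m * real p powr \<eta> * real h"
        using f(2)[of m p h U "real h"] m n p h U by simp
      also have "\<dots> \<le> c * real p powr \<eta> * real h"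
        using fc[of m] m n by (intro mult_right_mono) auto
      finally show ?thesis .
    qed
  qed
qed

section \<open>From reduced solutions to all solutions\<close>

text \<open>A solution is sent to its gcd and its reduced fraction. Since \<open>H < p\<close>, both
  \<open>y\<close> and the gcd are invertible modulo \<open>p\<close>: the former makes
  \<open>r\<close> recoverable from \<open>x\<close> and \<open>y\<close>, the latter lets the gcd
  be cancelled from the congruence.\<close>

lemma J_le_sum_reduced_solutions:
  assumes p: "prime p" and U: "small_doubling p U" and H: "H < p"
  shows "J p H U \<le> (\<Sum>d\<in>{1..H}. card (reduced_solutions p (H div d) U))"
proof -
  define T where "T = {(x, y, r). x \<in> {1..H} \<and> y \<in> {1..H} \<and> r \<in> U \<and> [int x = int y * r] (mod int p)}"
  define g where "g = (\<lambda>(x::nat, y::nat, r::int). (gcd x y, x div gcd x y, y div gcd x y))"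
  have cop: "coprime (int k) (int p)" if "1 \<le> k" "k \<le> H" for k
  proof -
    have "\<not> p dvd k" using that H nat_dvd_not_less by auto
    then have "coprime p k" by (rule prime_imp_coprime[OF p])
    then show ?thesis by (simp add: coprime_commute)
  qed
  have "inj_on g T"
  proof (rule inj_onI)
    fix s t assume st: "s \<in> T" "t \<in> T" "g s = g t"
    obtain x y r where s: "s = (x, y, r)" by (cases s)
    obtain x' y' r' where t: "t = (x', y', r')" by (cases t)
    have "x = x' \<and> y = y'" using st(3) unfolding s t g_def
      by (metis (no_types, lifting) case_prod_conv prod.inject dvd_mult_div_cancel gcd_dvd1 gcd_dvd2)
    moreover have "r = r'" if "y = y'" "x = x'"
    proof -
      have y: "1 \<le> y" "y \<le> H" and rU: "r \<in> U" "r' \<in> U"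
        and cg: "[int x = int y * r] (mod int p)" "[int x = int y * r'] (mod int p)"
        using st that by (auto simp: T_def s t)
      then have "[int y * r = int y * r'] (mod int p)" by (metis cong_sym cong_trans)
      then have "[r = r'] (mod int p)" using cop[OF y] by (simp add: cong_mult_lcancel)
      moreover have "0 \<le> r" "r < int p" "0 \<le> r'" "r' < int p"
        using rU small_doubling_subset[OF p U] by force+
      ultimately show ?thesis by (rule cong_less_imp_eq_int[rotated -1])
    qed
    ultimately show "s = t" by (simp add: s t)
  qed
  moreover have "g ` T \<subseteq> Sigma {1..H} (\<lambda>d. reduced_solutions p (H div d) U)"
  proof
    fix w assume "w \<in> g ` T"
    then obtain x y r where w: "w = g (x, y, r)" and x: "x \<in> {1..H}" and y: "y \<in> {1..H}"
      and r: "r \<in> U" and cg: "[int x = int y * r] (mod int p)"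
      by (auto simp: T_def)
    define d where "d = gcd x y"
    define a b where "a = x div d" and "b = y div d"
    have d0: "d > 0" using x by (simp add: d_def)
    have xa: "x = d * a" "y = d * b" by (simp_all add: a_def b_def d_def)
    have dH: "1 \<le> d" "d \<le> H" 
    proof -
      have "d dvd x" by (simp add: d_def)
      then have "d \<le> x" using x by (intro dvd_imp_le) auto
      then show "1 \<le> d" "d \<le> H" using d0 x by auto
    qed
    have ab: "a \<ge> 1" "b \<ge> 1" using x y xa by (auto simp: Suc_le_eq intro: Nat.gr0I)
    have "a \<le> H div d" "b \<le> H div d"
      using x y by (auto simp: a_def b_def intro: div_le_mono)
    moreover have "coprime a b"
      unfolding a_def b_def d_def using x by (intro div_gcd_coprime) auto
    moreover have "[int a = int b * r] (mod int p)"
    proof -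
      have "[int d * int a = int d * (int b * r)] (mod int p)"
        using cg by (simp add: xa mult.assoc)
      then show ?thesis using cop[OF dH] by (simp add: cong_mult_lcancel)
    qed
    ultimately have "(a, b) \<in> reduced_solutions p (H div d) U"
      using ab r by (auto simp: reduced_solutions_def)
    moreover have "w = (d, a, b)" by (simp add: w g_def a_def b_def d_def)
    ultimately show "w \<in> Sigma {1..H} (\<lambda>d. reduced_solutions p (H div d) U)" using dH by simp
  qed
  ultimately have "card T \<le> card (Sigma {1..H} (\<lambda>d. reduced_solutions p (H div d) U))"
    by (rule card_inj_on_le) auto
  then show ?thesis by (simp add: J_def T_def card_SigmaI)
qed

lemma sum_inverse_le_ln:
  assumes "H \<ge> 1"
  shows "(\<Sum>d\<in>{1..H::nat}. 1 / real d) \<le> 1 + ln (real H)"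
  using assms
proof (induction H rule: dec_induct)
  case (step H)
  have "ln (real H / real (Suc H)) \<le> real H / real (Suc H) - 1"
    using step by (intro ln_le_minus_one) simp
  also have "\<dots> = - (1 / real (Suc H))" by (simp add: field_simps)
  finally have "1 / real (Suc H) \<le> ln (real (Suc H)) - ln (real H)"
    using step by (simp add: ln_div)
  then show ?case using step by simp
qed simp

text \<open>At height \<open>h = H div d\<close> both \<open>h\<close> and \<open>h^2\<close> save a
  factor \<open>1/d\<close>, because \<open>h^2 \<le> H (H/d)\<close>. The harmonic sum that remains
  is at most \<open>1 + ln H\<close>, which is absorbed into \<open>p^\<eta>\<close>.\<close>

lemma J_le_of_reduced_solutions_bound:
  fixes a b \<eta> :: real
  assumes p: "prime p" and U: "small_doubling p U" and H: "1 \<le> H" "H < p" and \<eta>: "\<eta> > 0"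
    and ab: "a \<ge> 0" "b \<ge> 0"
    and bound: "\<And>h. 1 \<le> h \<Longrightarrow> h \<le> H \<Longrightarrow>
      real (card (reduced_solutions p h U)) \<le> a * real h + b * real h ^ 2"
  shows "real (J p H U) \<le> (a * real H + b * real H ^ 2) * ((1 + 1 / \<eta>) * real p powr \<eta>)"
proof -
  have "real (J p H U) \<le> real (\<Sum>d\<in>{1..H}. card (reduced_solutions p (H div d) U))"
    by (rule of_nat_mono[OF J_le_sum_reduced_solutions[OF p U H(2)]])
  also have "\<dots> = (\<Sum>d\<in>{1..H}. real (card (reduced_solutions p (H div d) U)))" by simp
  also have "\<dots> \<le> (\<Sum>d\<in>{1..H}. (a * real H + b * real H ^ 2) * (1 / real d))"
  proof (rule sum_mono)
    fix d assume d: "d \<in> {1..H}"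
    define h where "h = H div d"
    have h1: "1 \<le> h" using d by (simp add: h_def Suc_le_eq div_greater_zero_iff)
    have hH': "h \<le> H" unfolding h_def by (rule div_le_dividend)
    have hd: "real h \<le> real H / real d" unfolding h_def by (rule of_nat_div_le_of_nat)
    have hH: "real h \<le> real H" using hH' by simp
    have "real (card (reduced_solutions p h U)) \<le> a * real h + b * (real h * real h)"
      using bound[OF h1 hH'] by (simp add: power2_eq_square)
    also have "\<dots> \<le> a * (real H / real d) + b * (real H * (real H / real d))"
      using ab hd hH by (intro add_mono mult_left_mono mult_mono) auto
    finally show "real (card (reduced_solutions p (H div d) U))
        \<le> (a * real H + b * real H ^ 2) * (1 / real d)"
      by (simp add: h_def power2_eq_square algebra_simps add_divide_distrib)
  qed
  also have "\<dots> = (a * real H + b * real H ^ 2) * (\<Sum>d\<in>{1..H}. 1 / real d)"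
    by (simp only: sum_distrib_left)
  also have "\<dots> \<le> (a * real H + b * real H ^ 2) * ((1 + 1 / \<eta>) * real p powr \<eta>)"
  proof (rule mult_left_mono)
    have p1: "1 \<le> real p powr \<eta>" using H \<eta> by (intro ge_one_powr_ge_zero) auto
    have "ln (real H) \<le> ln (real p)" using H by simp
    also have "\<dots> \<le> real p powr \<eta> / \<eta>" using H \<eta> by (intro ln_powr_bound) auto
    finally have "1 + ln (real H) \<le> real p powr \<eta> + real p powr \<eta> / \<eta>" using p1 by simp
    then show "(\<Sum>d\<in>{1..H}. 1 / real d) \<le> (1 + 1 / \<eta>) * real p powr \<eta>"
      using sum_inverse_le_ln[OF H(1)] by (simp add: algebra_simps)
  qed (use ab in simp)
  finally show ?thesis .
qed

subsection \<open>Counting all solutions\<close>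

text \<open>Three ranges of \<open>h\<close>, with \<open>u = |U|\<close>. If
  \<open>h \<ge> (u p)^(1/4)\<close>, counting fractions per residue suffices, as
  \<open>u \<le> u^(3/4) h / p^(1/4)\<close>. If \<open>u^(1/2) \<le> h < (u p)^(1/4)\<close>, the
  second moment is used. If \<open>h^2 < u\<close>, then
  \<open>u h^2 < u^2 < p^(4/5) \<le> p\<close>, so the linear bound with \<open>n = 2\<close>
  applies.\<close>

lemma reduced_solutions_mixed_bound:
  fixes \<eta> :: real
  assumes \<eta>: "\<eta> > 0"
  obtains c :: real where "c \<ge> 1"
    "\<And>p h U. prime p \<Longrightarrow> 1 \<le> h \<Longrightarrow> h < p \<Longrightarrow> small_doubling p U \<Longrightarrow>
       real (card U) < real p powr (2 / 5) \<Longrightarrow>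
       real (card (reduced_solutions p h U)) \<le> c * real p powr \<eta> *
         (real h + real (card U) * real h ^ 2 / real p
          + real (card U) powr (3 / 4) * real h / real p powr (1 / 4))"
proof -
  obtain c1 :: real where c1: "c1 \<ge> 1"
    "\<And>p h U B. prime p \<Longrightarrow> h < p \<Longrightarrow> small_doubling p U \<Longrightarrow> B \<ge> 0 \<Longrightarrow>
       real (card U) * (1 + real h ^ (2 * 2) / real p) \<le> 2 * B ^ 2 \<Longrightarrow>
       real (card (reduced_solutions p h U)) \<le> c1 * real p powr \<eta> * B"
    using reduced_solutions_root_bound[of 2 \<eta>] \<eta> by auto
  obtain c2 :: real where c2: "c2 \<ge> 1"
    "\<And>p h U. prime p \<Longrightarrow> 1 \<le> h \<Longrightarrow> h < p \<Longrightarrow> small_doubling p U \<Longrightarrow>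
       real (card U) < real p powr (real 2 / (2 * real 2 + 1)) \<Longrightarrow> card U * h ^ 2 < p \<Longrightarrow>
       real (card (reduced_solutions p h U)) \<le> c2 * real p powr \<eta> * real h"
    using reduced_solutions_linear_bound[of 2 \<eta>] \<eta> by auto
  show thesis
  proof (rule that[of "c1 + c2 + 2"])
    show "c1 + c2 + 2 \<ge> 1" using c1 c2 by simp
    fix p h :: nat and U :: "int set"
    assume p: "prime p" and h1: "1 \<le> h" and hp: "h < p" and U: "small_doubling p U"
      and Up: "real (card U) < real p powr (2 / 5)"
    let ?A = "reduced_solutions p h U"
    define u where "u = real (card U)"
    \<comment> \<open>Fourth roots turn every exponent into an integer:
      \<open>u^(3/4) = v^3\<close>, and the threshold \<open>(u p)^(1/4)\<close> is
      \<open>v q\<close>.\<close>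
    define v where "v = u powr (1 / 4)"
    define q where "q = real p powr (1 / 4)"
    have p1: "real p \<ge> 1" using prime_ge_1_nat[OF p] by simp
    have u1: "u \<ge> 1" using small_doubling_card_pos[OF p U] by (simp add: u_def)
    have v: "v > 0" "u = v ^ 4" "u powr (3 / 4) = v ^ 3"
      using u1 by (simp_all add: v_def powr_powr flip: powr_realpow)
    have q: "q > 0" "real p = q ^ 4"
      using p1 by (simp_all add: q_def powr_powr flip: powr_realpow)
    define B where "B = real h + v ^ 3 * real h / q"
    define E where "E = real h + u * real h ^ 2 / real p + v ^ 3 * real h / q"
    have nn: "v ^ 3 * real h / q \<ge> 0" "u * real h ^ 2 / real p \<ge> 0"
      using v q u1 by simp_all
    have BE: "0 \<le> B" "B \<le> E" "real h \<le> E" "u * real h ^ 2 / real p + v ^ 3 * real h / q \<le> E"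
      using nn by (simp_all add: B_def E_def)
    have P1: "real p powr \<eta> \<ge> 1" using p1 \<eta> by (intro ge_one_powr_ge_zero) auto
    consider "real h \<ge> v * q" | "real h < v * q" "u \<le> real h ^ 2" | "real h ^ 2 < u" by linarith
    then have "\<exists>c\<in>{c1, c2, 2}. real (card ?A) \<le> c * real p powr \<eta> * E"
    proof cases
      case 1
      have "v ^ 3 * (v * q) \<le> v ^ 3 * real h" using 1 v by (intro mult_left_mono) auto
      then have "u \<le> v ^ 3 * real h / q"
        using q v by (simp add: pos_le_divide_eq eval_nat_numeral mult_ac)
      then have "2 * (u * (1 + real h ^ 2 / real p)) \<le> 2 * E"
        using BE by (simp add: distrib_left)
      moreover have "real (card ?A) \<le> 2 * u * (1 + real h ^ 2 / real p)"
        unfolding u_def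
        by (rule card_reduced_solutions_le) (use p small_doubling_finite[OF p U] prime_gt_0_nat in auto)
      ultimately have "real (card ?A) \<le> 2 * 1 * E" by simp
      also have "\<dots> \<le> 2 * real p powr \<eta> * E" using P1 BE by (intro mult_right_mono) auto
      finally show ?thesis by blast
    next
      case 2
      \<comment> \<open>Replacing one factor \<open>h^2\<close> by \<open>(v q)^2\<close> turns
        \<open>u h^4 / p\<close> into \<open>v^6 h^2 / q^2\<close>, the square of the second term of
        \<open>B\<close>.\<close>
      have "real h ^ 2 \<le> (v * q) ^ 2" using 2 by (intro power_mono) auto
      then have "(v ^ 4 * real h ^ 2) * real h ^ 2 \<le> (v ^ 4 * real h ^ 2) * (v * q) ^ 2"
        by (intro mult_left_mono) auto
      then have "v ^ 4 * real h ^ 4 / q ^ 4 \<le> (v ^ 4 * real h ^ 2) * (v * q) ^ 2 / q ^ 4"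
        using q by (intro divide_right_mono) (auto simp: eval_nat_numeral mult_ac)
      also have "\<dots> = (v ^ 3 * real h / q) ^ 2"
        using q by (simp add: power_mult_distrib power_divide field_simps eval_nat_numeral)
      also have "\<dots> \<le> B ^ 2" using nn by (intro power_mono) (auto simp: B_def)
      finally have 3: "u * real h ^ 4 / real p \<le> B ^ 2" by (simp add: v q)
      have "u \<le> B ^ 2"
      proof -
        have "real h \<le> B" using nn by (simp add: B_def)
        then have "real h ^ 2 \<le> B ^ 2" by (intro power_mono) auto
        then show ?thesis using 2 by linarith
      qed
      then have "real (card U) * (1 + real h ^ (2 * 2) / real p) \<le> 2 * B ^ 2"
        using 3 by (simp add: u_def distrib_left)
      then have "real (card ?A) \<le> c1 * real p powr \<eta> * B"
        using c1(2)[OF p hp U BE(1)] by blast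
      also have "\<dots> \<le> c1 * real p powr \<eta> * E"
        using BE c1 by (intro mult_left_mono) auto
      finally show ?thesis by blast
    next
      case 3
      have "real (card U * h ^ 2) = u * real h ^ 2" by (simp add: u_def)
      also have "\<dots> \<le> u * u" using 3 u1 by (intro mult_left_mono) auto
      also have "\<dots> < real p powr (2 / 5) * real p powr (2 / 5)"
        using Up u1 by (intro mult_strict_mono) (use p1 in \<open>auto simp: u_def\<close>)
      also have "\<dots> = real p powr (4 / 5)" by (simp flip: powr_add)
      also have "\<dots> \<le> real p powr 1" using p1 by (intro powr_mono) auto
      finally have "real (card U * h ^ 2) < real p" using p1 by simp
      then have "card U * h ^ 2 < p" by (simp only: of_nat_less_iff)
      then have "real (card ?A) \<le> c2 * real p powr \<eta> * real h"
        using Up by (intro c2(2)[OF p h1 hp U]) auto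
      also have "\<dots> \<le> c2 * real p powr \<eta> * E"
        using BE c2 by (intro mult_left_mono) auto
      finally show ?thesis by blast
    qed
    then obtain c where c: "c \<in> {c1, c2, 2}" "real (card ?A) \<le> c * (real p powr \<eta> * E)"
      by (auto simp: mult.assoc)
    have "E \<ge> 0" using BE by linarith
    then have "c * (real p powr \<eta> * E) \<le> (c1 + c2 + 2) * (real p powr \<eta> * E)"
      using c c1(1) c2(1) by (intro mult_right_mono) auto
    with c have "real (card ?A) \<le> (c1 + c2 + 2) * (real p powr \<eta> * E)" by linarith
    then show "real (card ?A) \<le> (c1 + c2 + 2) * real p powr \<eta> *
         (real h + real (card U) * real h ^ 2 / real p
          + real (card U) powr (3 / 4) * real h / real p powr (1 / 4))"
      by (simp only: E_def v(3)[symmetric] u_def q_def mult.assoc)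
  qed
qed

lemma J_le_of_prime_le:
  assumes p: "prime p" and U: "small_doubling p U" and H: "p \<le> H"
  shows "real (J p H U) \<le> 2 * (real (card U) * real H ^ 2 / real p)"
proof -
  have p0: "p > 0" using p prime_gt_0_nat by auto
  have finU: "finite U" by (rule small_doubling_finite[OF p U])
  define T where "T = {(x, y, r). x \<in> {1..H} \<and> y \<in> {1..H} \<and> r \<in> U \<and> [int x = int y * r] (mod int p)}"
  let ?g = "\<lambda>(x::nat, y::nat, r::int). (x div p, y, r)"
  have "inj_on ?g T"
  proof (rule inj_onI)
    fix s t assume st: "s \<in> T" "t \<in> T" "?g s = ?g t"
    obtain x y r where s: "s = (x, y, r)" by (cases s)
    obtain x' where t: "t = (x', y, r)" using st(3) s by (cases t) auto
    have "[int x = int x'] (mod int p)"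
      using st unfolding s t T_def by (auto intro: cong_trans cong_sym)
    then have "x mod p = x' mod p" unfolding cong_int_iff by (simp add: cong_def)
    moreover have "x div p = x' div p" using st(3) s t by simp
    ultimately have "x = x'" by (metis mult_div_mod_eq)
    then show "s = t" by (simp add: s t)
  qed
  moreover have "?g ` T \<subseteq> {..H div p} \<times> ({1..H} \<times> U)"
    by (auto simp: T_def intro: div_le_mono)
  ultimately have "card T \<le> card ({..H div p} \<times> ({1..H} \<times> U))"
    by (rule card_inj_on_le) (use finU in auto)
  then have "J p H U \<le> (H div p + 1) * (H * card U)"
    by (simp add: J_def T_def card_cartesian_product)
  then have "real (J p H U) \<le> real ((H div p + 1) * (H * card U))" by (rule of_nat_mono)
  also have "\<dots> = (real (H div p) + 1) * (real H * real (card U))"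
    by (simp only: of_nat_mult of_nat_add of_nat_1)
  also have "\<dots> \<le> (2 * (real H / real p)) * (real H * real (card U))"
  proof (rule mult_right_mono)
    have "real (H div p) \<le> real H / real p" by (rule of_nat_div_le_of_nat)
    moreover have "1 \<le> real H / real p" using H p0 by simp
    ultimately show "real (H div p) + 1 \<le> 2 * (real H / real p)" by simp
  qed simp
  finally show ?thesis by (simp add: power2_eq_square mult_ac)
qed

theorem theorem1:
  shows "(\<forall>n::nat. n \<ge> 1 \<longrightarrow> (\<forall>\<eta>::real. \<eta> > 0 \<longrightarrow> (\<exists>c::real.
           \<forall>(p::nat) (H::nat) (U::int set).
             prime p \<longrightarrow> H \<ge> 1 \<longrightarrow> small_doubling p U \<longrightarrow>
             real (card U) < real p powr (real n / (2 * real n + 1)) \<longrightarrow>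
             card U * H ^ n < p \<longrightarrow>
             real (J p H U) < c * real H * real p powr \<eta>))) \<and>
         (\<forall>\<eta>::real. \<eta> > 0 \<longrightarrow> (\<exists>c::real.
           \<forall>(p::nat) (H::nat) (U::int set).
             prime p \<longrightarrow> H \<ge> 1 \<longrightarrow> small_doubling p U \<longrightarrow>
             real (card U) < real p powr (2 / 5) \<longrightarrow>
             real (J p H U) <
               c * (real H + real (card U) * real H ^ 2 / real p
                    + real (card U) powr (3 / 4) * real H / real p powr (1 / 4)) * real p powr \<eta>))"
proof (intro conjI allI impI)
  fix n :: nat and \<eta> :: real
  assume n: "n \<ge> 1" and "\<eta> > 0"
  \<comment> \<open>One half of \<open>\<eta>\<close> pays for the bound on reduced solutions, the
    other for the harmonic sum over gcds.\<close>
  then have \<eta>: "\<eta> / 2 > 0" by simp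
  obtain c :: real where c: "c \<ge> 1"
    "\<And>p h U. prime p \<Longrightarrow> 1 \<le> h \<Longrightarrow> h < p \<Longrightarrow> small_doubling p U \<Longrightarrow>
       real (card U) < real p powr (real n / (2 * real n + 1)) \<Longrightarrow> card U * h ^ n < p \<Longrightarrow>
       real (card (reduced_solutions p h U)) \<le> c * real p powr (\<eta> / 2) * real h"
    using reduced_solutions_linear_bound[OF n \<eta>] by blast
  define C where "C = c * (1 + 1 / (\<eta> / 2))"
  show "\<exists>c::real. \<forall>(p::nat) (H::nat) (U::int set).
             prime p \<longrightarrow> H \<ge> 1 \<longrightarrow> small_doubling p U \<longrightarrow>
             real (card U) < real p powr (real n / (2 * real n + 1)) \<longrightarrow>
             card U * H ^ n < p \<longrightarrow>
             real (J p H U) < c * real H * real p powr \<eta>"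
  proof (intro exI[of _ "C + 1"] allI impI)
    fix p H :: nat and U :: "int set"
    assume p: "prime p" and H1: "H \<ge> 1" and U: "small_doubling p U"
      and Up: "real (card U) < real p powr (real n / (2 * real n + 1))" and UH: "card U * H ^ n < p"
    have p1: "real p \<ge> 1" using prime_ge_1_nat[OF p] by simp
    \<comment> \<open>In part (i) the range \<open>H \<ge> p\<close> cannot occur, since
      \<open>U\<close> is nonempty and \<open>n \<ge> 1\<close>.\<close>
    have Hp: "H < p"
    proof -
      have "1 * H ^ 1 \<le> card U * H ^ n"
        using small_doubling_card_pos[OF p U] H1 n by (intro mult_mono power_increasing) auto
      then show ?thesis using UH by simp
    qed
    have "real (J p H U) \<le> (c * real p powr (\<eta> / 2) * real H + 0 * real H ^ 2)
        * ((1 + 1 / (\<eta> / 2)) * real p powr (\<eta> / 2))"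
    proof (rule J_le_of_reduced_solutions_bound[OF p U H1 Hp \<eta>])
      fix h assume h: "1 \<le> h" "h \<le> H"
      have "card U * h ^ n \<le> card U * H ^ n" using h by (intro mult_left_mono power_mono) auto
      then have "card U * h ^ n < p" using UH by linarith
      then show "real (card (reduced_solutions p h U))
          \<le> c * real p powr (\<eta> / 2) * real h + 0 * real h ^ 2"
        using c(2)[OF p h(1) _ U Up] h Hp by simp
    qed (use c in auto)
    also have "\<dots> = C * real H * (real p powr (\<eta> / 2) * real p powr (\<eta> / 2))"
      by (simp add: C_def mult_ac)
    also have "real p powr (\<eta> / 2) * real p powr (\<eta> / 2) = real p powr \<eta>"
      by (simp flip: powr_add)
    also have "C * real H * real p powr \<eta> < (C + 1) * real H * real p powr \<eta>"
      using H1 p1 by (intro mult_strict_right_mono) auto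
    finally show "real (J p H U) < (C + 1) * real H * real p powr \<eta>" .
  qed
next
  fix \<eta> :: real
  assume \<eta>0: "\<eta> > 0"
  then have \<eta>: "\<eta> / 2 > 0" by simp
  obtain c :: real where c: "c \<ge> 1"
    "\<And>p h U. prime p \<Longrightarrow> 1 \<le> h \<Longrightarrow> h < p \<Longrightarrow> small_doubling p U \<Longrightarrow>
       real (card U) < real p powr (2 / 5) \<Longrightarrow>
       real (card (reduced_solutions p h U)) \<le> c * real p powr (\<eta> / 2) *
         (real h + real (card U) * real h ^ 2 / real p
          + real (card U) powr (3 / 4) * real h / real p powr (1 / 4))"
    using reduced_solutions_mixed_bound[OF \<eta>] by blast
  define C where "C = c * (1 + 1 / (\<eta> / 2))"
  have C0: "C \<ge> 0" using c \<eta>0 by (simp add: C_def)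
  show "\<exists>c::real. \<forall>(p::nat) (H::nat) (U::int set).
             prime p \<longrightarrow> H \<ge> 1 \<longrightarrow> small_doubling p U \<longrightarrow>
             real (card U) < real p powr (2 / 5) \<longrightarrow>
             real (J p H U) <
               c * (real H + real (card U) * real H ^ 2 / real p
                    + real (card U) powr (3 / 4) * real H / real p powr (1 / 4)) * real p powr \<eta>"
  \<comment> \<open>\<open>C\<close> covers \<open>H < p\<close>, the 2 covers
    \<open>H \<ge> p\<close>, and the remaining 1 makes the inequality strict.\<close>
  proof (intro exI[of _ "C + 3"] allI impI)
    fix p H :: nat and U :: "int set"
    assume p: "prime p" and H1: "H \<ge> 1" and U: "small_doubling p U"
      and Up: "real (card U) < real p powr (2 / 5)"
    have p1: "real p \<ge> 1" using prime_ge_1_nat[OF p] by simp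
    \<comment> \<open>\<open>b\<close> and \<open>\<beta>\<close> write the three terms as a linear
      plus a quadratic term in the height, the shape required for the sum over gcds.\<close>
    define b where "b = real (card U) / real p"
    define \<beta> where "\<beta> = real (card U) powr (3 / 4) / real p powr (1 / 4)"
    define E where "E = (1 + \<beta>) * real H + b * real H ^ 2"
    have nn: "b \<ge> 0" "\<beta> \<ge> 0" by (simp_all add: b_def \<beta>_def)
    have E_eq: "real h + real (card U) * real h ^ 2 / real p
          + real (card U) powr (3 / 4) * real h / real p powr (1 / 4)
        = (1 + \<beta>) * real h + b * real h ^ 2" for h
      by (simp add: b_def \<beta>_def algebra_simps)
    have E0: "E > 0"
      unfolding E_def using nn H1 by (intro add_pos_nonneg mult_pos_pos) auto
    have P1: "real p powr \<eta> \<ge> 1" using p1 \<eta>0 by (intro ge_one_powr_ge_zero) auto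
    have "real (J p H U) \<le> (C + 2) * E * real p powr \<eta>"
    proof (cases "H < p")
      case True
      have "real (J p H U) \<le> ((c * real p powr (\<eta> / 2) * (1 + \<beta>)) * real H
          + (c * real p powr (\<eta> / 2) * b) * real H ^ 2)
          * ((1 + 1 / (\<eta> / 2)) * real p powr (\<eta> / 2))"
      proof (rule J_le_of_reduced_solutions_bound[OF p U H1 True \<eta>])
        fix h assume h: "1 \<le> h" "h \<le> H"
        show "real (card (reduced_solutions p h U)) \<le> (c * real p powr (\<eta> / 2) * (1 + \<beta>)) * real h
          + (c * real p powr (\<eta> / 2) * b) * real h ^ 2"
          using c(2)[OF p h(1) _ U Up] h True unfolding E_eq by (simp add: algebra_simps)
      qed (use c nn in auto)
      also have "\<dots> = C * E * (real p powr (\<eta> / 2) * real p powr (\<eta> / 2))"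
        by (simp add: C_def E_def algebra_simps)
      also have "real p powr (\<eta> / 2) * real p powr (\<eta> / 2) = real p powr \<eta>"
        by (simp flip: powr_add)
      also have "C * E * real p powr \<eta> \<le> (C + 2) * E * real p powr \<eta>"
        using E0 by (intro mult_right_mono) auto
      finally show ?thesis .
    next
      case False
      have "real (J p H U) \<le> 2 * (b * real H ^ 2)"
        using J_le_of_prime_le[OF p U] False by (simp add: b_def)
      also have "\<dots> \<le> 2 * E"
        using nn by (simp add: E_def)
      also have "\<dots> \<le> ((C + 2) * E) * 1" using E0 C0 by simp
      also have "\<dots> \<le> ((C + 2) * E) * real p powr \<eta>"
        using P1 E0 C0 by (intro mult_left_mono) auto
      finally show ?thesis .
    qed
    also have "\<dots> < (C + 3) * E * real p powr \<eta>"
      using E0 p1 by (intro mult_strict_right_mono) auto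
    finally show "real (J p H U) < (C + 3) * (real H + real (card U) * real H ^ 2 / real p
                    + real (card U) powr (3 / 4) * real H / real p powr (1 / 4)) * real p powr \<eta>"
      unfolding E_eq E_def .
  qed
qed

end
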